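(* Irreducible seminormal representations of the Iwahori-Hecke algebra $HG_2(p^2,q^2)$ over $\mathbb{C}(p,q)$ (with respect to the chain $HA_0\subseteq HA_1(p^2)\subseteq HG_2(p^2,q^2)$), indexed by the labels $\phi_{1,0},\phi_{1,6},\phi_{1,3}',\phi_{1,3}'',\phi_{2,1},\phi_{2,2}$ of the irreducible representations of $WG_2$, are given explicitly by $$\phi_{1,0}(T_1)=(p),\ \ \phi_{1,0}(T_2)=(q);\qquad \phi_{1,6}(T_1)=(-p^{-1}),\ \ \phi_{1,6}(T_2)=(-q^{-1});$$ $$\phi_{1,3}'(T_1)=(p),\ \ \phi_{1,3}'(T_2)=(-q^{-1});\qquad \phi_{1,3}''(T_1)=(-p^{-1}),\ \ \phi_{1,3}''(T_2)=(q);$$ $$\phi_{2,1}(T_1)=\begin{pmatrix}p&0\\0&-p^{-1}\end{pmatrix},\ \phi_{2,1}(T_2)=\begin{pmatrix}a&b\\ c&d\end{pmatrix};\qquad \phi_{2,2}(T_1)=\begin{pmatrix}p&0\\0&-p^{-1}\end{pmatrix},\ \phi_{2,2}(T_2)=\begin{pmatrix}x&y\\ z&w\end{pmatrix},$$ where $$a=\frac{1+p^{-1}(q-q^{-1})}{p+p^{-1}},\quad b=q-a,\quad c=q^{-1}+a,\quad d=(q-q^{-1})-a,$$ $$x=\frac{-1+p^{-1}(q-q^{-1})}{p+p^{-1}},\quad y=q-x,\quad z=q^{-1}+x,\quad w=(q-q^{-1})-x.$$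
   Context: $p,q$ are indeterminates. $HG_2(p^2,q^2)$ is the associative $\mathbb{C}(p,q)$-algebra with $1$ with generators $T_1,T_2$ and relations $T_1T_2T_1T_2T_1T_2=T_2T_1T_2T_1T_2T_1$, $T_1^2=(p-p^{-1})T_1+1$, $T_2^2=(q-q^{-1})T_2+1$. $HA_1(p^2)$ is the subalgebra generated by $T_1$ and $HA_0=\mathbb{C}(p,q)\cdot1$. $WG_2$ is the dihedral group of order $12$ generated by $s_1,s_2$ with $s_1s_2s_1s_2s_1s_2=s_2s_1s_2s_1s_2s_1$, $s_1^2=s_2^2=1$. Its irreducible characters are labeled by their values on $(1,\ s_1,\ s_2,\ s_1s_2,\ (s_1s_2)^2,\ (s_1s_2)^3)$: $\phi_{1,0}:(1,1,1,1,1,1)$; $\phi_{1,6}:(1,-1,-1,1,1,1)$; $\phi_{1,3}':(1,1,-1,-1,1,-1)$; $\phi_{1,3}'':(1,-1,1,-1,1,-1)$; $\phi_{2,1}:(2,0,0,1,-1,-2)$; $\phi_{2,2}:(2,0,0,-1,-1,2)$. The irreducible representations of $HG_2(p^2,q^2)$ (a split semisimple algebra) are indexed by the same labels, the representation labeled $\phi$ corresponding to the representation $\phi$ of $WG_2$ under specialization $p=q=1$, $T_i\mapsto s_i$. A basis of an irreducible module $V$ of the last algebra of a chain $H_0\subseteq\cdots\subseteq H_n$ of split semisimple algebras is seminormal if it can be partitioned into subsets whose spans are irreducible $H_{n-1}$-submodules (so that $V$ is their direct sum), each of these subsets can in turn be partitioned so as to realize the decomposition into irreducibles upon restriction to $H_{n-2}$,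 and so on down the chain. A seminormal representation is the matrix representation with respect to a seminormal basis. *)

theory Defs
  imports
    "HOL-Computational_Algebra.Fraction_Field"
    "HOL-Library.Poly_Mapping"
    "HOL-Library.Disjoint_Sets"
    "Jordan_Normal_Form.VS_Connect"
begin

section \<open>The field of rational functions in p and q over the complex numbers\<close>

text \<open>Bivariate polynomials are polynomials in \<open>q\<close> whose coefficients are polynomials in \<open>p\<close>.\<close>

type_synonym Cpq = "complex poly poly fract"

definition p_ind :: Cpq where
  "p_ind = Fract [:[:0, 1:]:] 1"

definition q_ind :: Cpq where
  "q_ind = Fract [:0, 1:] 1"

text \<open>\<open>specializes r c\<close>: the rational function \<open>r\<close> is defined at \<open>p = q = 1\<close> and has the value \<open>c\<close>
  there.\<close>

definition specializes :: "Cpq \<Rightarrow> complex \<Rightarrow> bool" where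
  "specializes r c \<longleftrightarrow> (\<exists>f g :: complex poly poly.
     poly (poly g 1) 1 \<noteq> 0 \<and> r = Fract f g \<and> c = poly (poly f 1) 1 / poly (poly g 1) 1)"

definition mat_specializes :: "Cpq mat \<Rightarrow> complex mat \<Rightarrow> bool" where
  "mat_specializes A B \<longleftrightarrow> dim_row A = dim_row B \<and> dim_col A = dim_col B \<and>
     (\<forall>i < dim_row A. \<forall>j < dim_col A. specializes (A $$ (i, j)) (B $$ (i, j)))"

section \<open>The free monoid on two generators\<close>

datatype gen = G1 | G2

datatype gword = Word "gen list"

text \<open>The free monoid is written additively because the product of \<^type>\<open>poly_mapping\<close> is the
  convolution with respect to an additive monoid of exponents.\<close>

instantiation gword :: monoid_add
begin

definition zero_gword :: gword where
  "0 = Word []"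

fun plus_gword :: "gword \<Rightarrow> gword \<Rightarrow> gword" where
  "Word u + Word v = Word (u @ v)"

instance
proof
  fix a b c :: gword
  show "a + b + c = a + (b + c)"
    by (cases a; cases b; cases c) simp
  show "0 + a = a"
    by (cases a) (simp add: zero_gword_def)
  show "a + 0 = a"
    by (cases a) (simp add: zero_gword_def)
qed

end

section \<open>The Iwahori-Hecke algebra\<close>

text \<open>The free associative unital algebra on two generators.\<close>

type_synonym free_alg = "gword \<Rightarrow>\<^sub>0 Cpq"

definition free_scalar :: "Cpq \<Rightarrow> free_alg" where
  "free_scalar c = Poly_Mapping.single 0 c"

definition X1 :: free_alg where
  "X1 = Poly_Mapping.single (Word [G1]) 1"

definition X2 :: free_alg where
  "X2 = Poly_Mapping.single (Word [G2]) 1"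

definition hg2_relators :: "free_alg set" where
  "hg2_relators =
     {X1 * X2 * X1 * X2 * X1 * X2 - X2 * X1 * X2 * X1 * X2 * X1,
      X1 ^ 2 - (free_scalar (p_ind - inverse p_ind) * X1 + 1),
      X2 ^ 2 - (free_scalar (q_ind - inverse q_ind) * X2 + 1)}"

text \<open>The two-sided ideal generated by the relators; it is closed under scalar multiplication
  because the scalars lie in the algebra.\<close>

inductive_set hg2_ideal :: "free_alg set" where
  base: "r \<in> hg2_relators \<Longrightarrow> r \<in> hg2_ideal"
| zero: "0 \<in> hg2_ideal"
| diff: "x \<in> hg2_ideal \<Longrightarrow> y \<in> hg2_ideal \<Longrightarrow> x - y \<in> hg2_ideal"
| left: "x \<in> hg2_ideal \<Longrightarrow> a * x \<in> hg2_ideal"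
| right: "x \<in> hg2_ideal \<Longrightarrow> x * a \<in> hg2_ideal"

lemma hg2_ideal_uminus: "x \<in> hg2_ideal \<Longrightarrow> - x \<in> hg2_ideal"
  using hg2_ideal.diff[OF hg2_ideal.zero, of x] by simp

lemma hg2_ideal_add: "x \<in> hg2_ideal \<Longrightarrow> y \<in> hg2_ideal \<Longrightarrow> x + y \<in> hg2_ideal"
  using hg2_ideal.diff[of x "- y"] hg2_ideal_uminus by simp

definition hg2_cong :: "free_alg \<Rightarrow> free_alg \<Rightarrow> bool" where
  "hg2_cong x y \<longleftrightarrow> x - y \<in> hg2_ideal"

lemma equivp_hg2_cong: "equivp hg2_cong"
proof (rule equivpI)
  show "reflp hg2_cong"
    by (auto simp: reflp_def hg2_cong_def hg2_ideal.zero)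
  show "symp hg2_cong"
    unfolding symp_def hg2_cong_def by (metis hg2_ideal_uminus minus_diff_eq)
  show "transp hg2_cong"
  proof (rule transpI)
    fix x y z assume "hg2_cong x y" "hg2_cong y z"
    then show "hg2_cong x z"
      using hg2_ideal_add[of "x - y" "y - z"] by (simp add: hg2_cong_def)
  qed
qed

quotient_type hg2 = free_alg / hg2_cong
  by (rule equivp_hg2_cong)

instantiation hg2 :: "{ring, monoid_mult}"
begin

lift_definition zero_hg2 :: hg2 is 0 .

lift_definition one_hg2 :: hg2 is 1 .

lift_definition plus_hg2 :: "hg2 \<Rightarrow> hg2 \<Rightarrow> hg2" is "(+)"
proof -
  fix a b c d :: free_alg
  assume "hg2_cong a b" "hg2_cong c d"
  then have "(a - b) + (c - d) \<in> hg2_ideal"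
    unfolding hg2_cong_def by (rule hg2_ideal_add)
  moreover have "(a - b) + (c - d) = (a + c) - (b + d)"
    by (simp only: add_diff_add)
  ultimately show "hg2_cong (a + c) (b + d)"
    by (simp only: hg2_cong_def)
qed

lift_definition uminus_hg2 :: "hg2 \<Rightarrow> hg2" is uminus
proof -
  fix a b :: free_alg
  assume "hg2_cong a b"
  then have "- (a - b) \<in> hg2_ideal"
    unfolding hg2_cong_def by (rule hg2_ideal_uminus)
  moreover have "- (a - b) = - a - - b"
    by (simp only: minus_diff_minus)
  ultimately show "hg2_cong (- a) (- b)"
    by (simp only: hg2_cong_def)
qed

lift_definition minus_hg2 :: "hg2 \<Rightarrow> hg2 \<Rightarrow> hg2" is "(-)"
proof -
  fix a b c d :: free_alg
  assume "hg2_cong a b" "hg2_cong c d"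
  then have "(a - b) - (c - d) \<in> hg2_ideal"
    unfolding hg2_cong_def by (rule hg2_ideal.diff)
  moreover have "(a - b) - (c - d) = (a - c) - (b - d)"
    by simp
  ultimately show "hg2_cong (a - c) (b - d)"
    by (simp only: hg2_cong_def)
qed

lift_definition times_hg2 :: "hg2 \<Rightarrow> hg2 \<Rightarrow> hg2" is "(*)"
proof -
  fix a b c d :: free_alg
  assume "hg2_cong a b" "hg2_cong c d"
  then have "(a - b) * c + b * (c - d) \<in> hg2_ideal"
    unfolding hg2_cong_def by (intro hg2_ideal_add hg2_ideal.left hg2_ideal.right)
  then show "hg2_cong (a * c) (b * d)"
    by (simp add: hg2_cong_def algebra_simps)
qed

instance
  by standard (transfer; simp add: algebra_simps hg2_cong_def hg2_ideal.zero)+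

end

lift_definition hg2_scalar :: "Cpq \<Rightarrow> hg2" is free_scalar .

lift_definition T1 :: hg2 is X1 .

lift_definition T2 :: hg2 is X2 .

definition hg2_subalgebra :: "hg2 set \<Rightarrow> bool" where
  "hg2_subalgebra S \<longleftrightarrow> range hg2_scalar \<subseteq> S \<and>
     (\<forall>x\<in>S. \<forall>y\<in>S. x + y \<in> S) \<and> (\<forall>x\<in>S. \<forall>y\<in>S. x * y \<in> S)"

definition HA0 :: "hg2 set" where
  "HA0 = range hg2_scalar"

definition HA1 :: "hg2 set" where
  "HA1 = hg2_subalgebra hull {T1}"

lemma hg2_braid: "T1 * T2 * T1 * T2 * T1 * T2 = T2 * T1 * T2 * T1 * T2 * T1"
  by transfer (auto simp: hg2_cong_def hg2_relators_def intro: hg2_ideal.base)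

lemma hg2_quadratic1: "T1 ^ 2 = hg2_scalar (p_ind - inverse p_ind) * T1 + 1"
  unfolding power2_eq_square
  by transfer (auto simp: hg2_cong_def hg2_relators_def power2_eq_square intro: hg2_ideal.base)

lemma hg2_quadratic2: "T2 ^ 2 = hg2_scalar (q_ind - inverse q_ind) * T2 + 1"
  unfolding power2_eq_square
  by transfer (auto simp: hg2_cong_def hg2_relators_def power2_eq_square intro: hg2_ideal.base)

section \<open>Matrix representations and seminormal bases\<close>

definition hg2_rep :: "nat \<Rightarrow> (hg2 \<Rightarrow> Cpq mat) \<Rightarrow> bool" where
  "hg2_rep n \<rho> \<longleftrightarrow> (\<forall>x. \<rho> x \<in> carrier_mat n n) \<and> \<rho> 1 = 1\<^sub>m n \<and>
     (\<forall>x y. \<rho> (x + y) = \<rho> x + \<rho> y) \<and> (\<forall>x y. \<rho> (x * y) = \<rho> x * \<rho> y) \<and>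
     (\<forall>c x. \<rho> (hg2_scalar c * x) = c \<cdot>\<^sub>m \<rho> x)"

abbreviation Kvec :: "nat \<Rightarrow> (Cpq, Cpq vec) Module.module" where
  "Kvec n \<equiv> module_vec TYPE(Cpq) n"

text \<open>In the following, \<open>\<rho>\<close> turns the space of column vectors of dimension \<open>n\<close> into a module, and
  \<open>H\<close> is a subalgebra.\<close>

definition invariant_subspace :: "nat \<Rightarrow> (hg2 \<Rightarrow> Cpq mat) \<Rightarrow> hg2 set \<Rightarrow> Cpq vec set \<Rightarrow> bool" where
  "invariant_subspace n \<rho> H W \<longleftrightarrow>
     VectorSpace.subspace class_ring W (Kvec n) \<and> (\<forall>h\<in>H. \<forall>v\<in>W. \<rho> h *\<^sub>v v \<in> W)"

definition irreducible_subspace :: "nat \<Rightarrow> (hg2 \<Rightarrow> Cpq mat) \<Rightarrow> hg2 set \<Rightarrow> Cpq vec set \<Rightarrow> bool" where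
  "irreducible_subspace n \<rho> H W \<longleftrightarrow> invariant_subspace n \<rho> H W \<and> W \<noteq> {0\<^sub>v n} \<and>
     (\<forall>U. invariant_subspace n \<rho> H U \<longrightarrow> U \<subseteq> W \<longrightarrow> U = {0\<^sub>v n} \<or> U = W)"

definition irreducible_rep :: "nat \<Rightarrow> (hg2 \<Rightarrow> Cpq mat) \<Rightarrow> bool" where
  "irreducible_rep n \<rho> \<longleftrightarrow> hg2_rep n \<rho> \<and> irreducible_subspace n \<rho> UNIV (carrier_vec n)"

text \<open>\<open>P\<close> need only partition \<open>B\<close>: when \<open>B\<close> is linearly independent, the sum of the spans of the
  blocks is automatically direct. The chain of subalgebras is listed from the largest to the
  smallest.\<close>

fun seminormal_split ::
    "nat \<Rightarrow> (hg2 \<Rightarrow> Cpq mat) \<Rightarrow> hg2 set list \<Rightarrow> Cpq vec set \<Rightarrow> bool" where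
  "seminormal_split n \<rho> [] B \<longleftrightarrow> True"
| "seminormal_split n \<rho> (H # Hs) B \<longleftrightarrow> (\<exists>P. partition_on B P \<and>
     (\<forall>C\<in>P. irreducible_subspace n \<rho> H (LinearCombinations.module.span class_ring (Kvec n) C) \<and>
        seminormal_split n \<rho> Hs C))"

definition seminormal_basis ::
    "nat \<Rightarrow> (hg2 \<Rightarrow> Cpq mat) \<Rightarrow> hg2 set list \<Rightarrow> Cpq vec set \<Rightarrow> bool" where
  "seminormal_basis n \<rho> Hs B \<longleftrightarrow>
     vectorspace.basis class_ring (Kvec n) B \<and> seminormal_split n \<rho> Hs B"

text \<open>A matrix representation is the one with respect to the standard basis of the module of column
  vectors.\<close>

definition irreducible_seminormal_rep :: "nat \<Rightarrow> (hg2 \<Rightarrow> Cpq mat) \<Rightarrow> bool" where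
  "irreducible_seminormal_rep n \<rho> \<longleftrightarrow>
     irreducible_rep n \<rho> \<and> seminormal_basis n \<rho> [HA1, HA0] (set (unit_vecs n))"

definition equivalent_reps ::
    "nat \<Rightarrow> (hg2 \<Rightarrow> Cpq mat) \<Rightarrow> nat \<Rightarrow> (hg2 \<Rightarrow> Cpq mat) \<Rightarrow> bool" where
  "equivalent_reps m \<rho> n \<sigma> \<longleftrightarrow> m = n \<and>
     (\<exists>P \<in> carrier_mat n n. invertible_mat P \<and> (\<forall>x. P * \<rho> x = \<sigma> x * P))"

section \<open>The dihedral group of order 12 and its irreducible characters\<close>

text \<open>The generators being involutions, the group is the monoid with the same presentation.\<close>

inductive wg2_cong :: "gword \<Rightarrow> gword \<Rightarrow> bool" where
  refl: "wg2_cong u u"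
| sym: "wg2_cong u v \<Longrightarrow> wg2_cong v u"
| trans: "wg2_cong u v \<Longrightarrow> wg2_cong v w \<Longrightarrow> wg2_cong u w"
| mult: "wg2_cong u v \<Longrightarrow> wg2_cong u' v' \<Longrightarrow> wg2_cong (u + u') (v + v')"
| invol: "wg2_cong (Word [g, g]) (Word [])"
| braid: "wg2_cong (Word [G1, G2, G1, G2, G1, G2]) (Word [G2, G1, G2, G1, G2, G1])"

lemma equivp_wg2_cong: "equivp wg2_cong"
  by (intro equivpI reflpI sympI transpI) (blast intro: wg2_cong.intros)+

quotient_type wg2 = gword / wg2_cong
  by (rule equivp_wg2_cong)

instantiation wg2 :: monoid_mult
begin

lift_definition one_wg2 :: wg2 is 0 .

lift_definition times_wg2 :: "wg2 \<Rightarrow> wg2 \<Rightarrow> wg2" is "(+)"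
  by (rule wg2_cong.mult)

instance
  by standard (transfer; simp add: add.assoc wg2_cong.refl)+

end

lift_definition s1 :: wg2 is "Word [G1]" .

lift_definition s2 :: wg2 is "Word [G2]" .

lemma wg2_inverse: "\<exists>h. g * h = 1 \<and> h * g = (1 :: wg2)"
proof transfer
  fix w :: gword
  obtain l where w: "w = Word l" by (cases w)
  have 1: "wg2_cong (Word (k @ rev k)) (Word [])" for k :: "gen list"
  proof (induction k)
    case Nil
    then show ?case by (simp add: wg2_cong.refl)
  next
    case (Cons g k)
    have "wg2_cong (Word [g] + (Word (k @ rev k) + Word [g])) (Word [g] + (Word [] + Word [g]))"
      by (intro wg2_cong.mult wg2_cong.refl Cons.IH)
    then show ?case
      using wg2_cong.trans wg2_cong.invol by fastforce
  qed
  show "\<exists>h. wg2_cong (w + h) 0 \<and> wg2_cong (h + w) 0"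
    using 1[of l] 1[of "rev l"] by (intro exI[of _ "Word (rev l)"]) (simp add: w zero_gword_def)
qed

definition wg2_rep :: "nat \<Rightarrow> (wg2 \<Rightarrow> complex mat) \<Rightarrow> bool" where
  "wg2_rep n \<sigma> \<longleftrightarrow> (\<forall>g. \<sigma> g \<in> carrier_mat n n) \<and> \<sigma> 1 = 1\<^sub>m n \<and>
     (\<forall>g h. \<sigma> (g * h) = \<sigma> g * \<sigma> h)"

definition wg2_character :: "(wg2 \<Rightarrow> complex mat) \<Rightarrow> wg2 \<Rightarrow> complex" where
  "wg2_character \<sigma> g = sum_list (diag_mat (\<sigma> g))"

text \<open>In the labels a trailing \<open>a\<close> stands for one prime and a trailing \<open>b\<close> for two.\<close>

datatype wg2_label = phi_1_0 | phi_1_6 | phi_1_3a | phi_1_3b | phi_2_1 | phi_2_2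

definition wg2_class_reps :: "wg2 list" where
  "wg2_class_reps = [1, s1, s2, s1 * s2, (s1 * s2) ^ 2, (s1 * s2) ^ 3]"

fun wg2_character_table :: "wg2_label \<Rightarrow> complex list" where
  "wg2_character_table phi_1_0  = [1,  1,  1,  1,  1,  1]"
| "wg2_character_table phi_1_6  = [1, -1, -1,  1,  1,  1]"
| "wg2_character_table phi_1_3a = [1,  1, -1, -1,  1, -1]"
| "wg2_character_table phi_1_3b = [1, -1,  1, -1,  1, -1]"
| "wg2_character_table phi_2_1  = [2,  0,  0,  1, -1, -2]"
| "wg2_character_table phi_2_2  = [2,  0,  0, -1, -1,  2]"

fun label_dim :: "wg2_label \<Rightarrow> nat" where
  "label_dim phi_2_1 = 2"
| "label_dim phi_2_2 = 2"
| "label_dim _ = 1"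

definition specializes_to_label :: "nat \<Rightarrow> (hg2 \<Rightarrow> Cpq mat) \<Rightarrow> wg2_label \<Rightarrow> bool" where
  "specializes_to_label n \<rho> \<phi> \<longleftrightarrow> (\<exists>\<sigma>. wg2_rep n \<sigma> \<and>
     mat_specializes (\<rho> T1) (\<sigma> s1) \<and> mat_specializes (\<rho> T2) (\<sigma> s2) \<and>
     map (wg2_character \<sigma>) wg2_class_reps = wg2_character_table \<phi>)"

end

theory Submission
  imports Defs
begin

text \<open>The elements \<open>E1 = T1 + p\<^sup>-\<^sup>1\<close> and \<open>E2 = T2 + q\<^sup>-\<^sup>1\<close> are idempotents up to a scalar. With
  \<open>s = p/q + q/p\<close> the braid relation says that \<open>(E1 E2)\<^sup>3 - 2s (E1 E2)\<^sup>2 + (s\<^sup>2 - 1) E1 E2\<close> is unchanged when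
  \<open>E1\<close> and \<open>E2\<close> are exchanged, so its image consists of common eigenvectors of \<open>T1\<close> and \<open>T2\<close>. Hence on
  a nonzero module either \<open>T1\<close> and \<open>T2\<close> have a common eigenvector, or some vector of \<open>E1 V\<close> is an
  eigenvector of \<open>E1 E2\<close> with eigenvalue \<open>s + 1\<close> or \<open>s - 1\<close>. In the first case this gives a nonzero
  intertwiner from one of the four one-dimensional representations, in the second from \<open>\<phi>\<^bsub>2,1\<^esub>\<close> or
  \<open>\<phi>\<^bsub>2,2\<^esub>\<close>, and Schur's lemma makes it an isomorphism. All required nonvanishing of coefficients
  is read off at \<open>p = q = 1\<close>, and traces tell the six representations apart.\<close>

section \<open>Scalars and generators\<close>

text \<open>The classification has to cover irreducible modules of every finite dimension, over a
  field that is not algebraically closed, so eigenvectors do not come for free. What makes them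
  available is that the cubic hidden in the braid relation splits over C(p,q): X^3 - 2s X^2 + (s^2 -
  1) X = X (X - (s+1)) (X - (s-1)). An eigenvector of \<open>E1 * E2\<close> is therefore reached by
  stripping off linear factors one at a time. A single parameter t, equal to 1 or -1, governs the
  two-dimensional case. It is the trace of \<open>T1 * T2\<close>, it selects the eigenvalue s + t,
  and since \<open>T1 * T2\<close> has determinant 1, Cayley-Hamilton makes its cube the scalar -t.
  That scalar is why the given matrices satisfy the braid relation, and t is also what separates the
  two labels.\<close>

lemma poly_mapping_add_single_induct [case_names single add]:
  fixes f :: "'a \<Rightarrow>\<^sub>0 'b::comm_monoid_add"
  assumes "\<And>k c. P (Poly_Mapping.single k c)"
    and "\<And>f g. P f \<Longrightarrow> P g \<Longrightarrow> P (f + g)"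
  shows "P f"
proof (induction f rule: update_induct)
  case const
  \<comment> \<open>The key is arbitrary because a monomial with coefficient 0 is the zero
    mapping.\<close>
  show ?case using assms(1)[of undefined 0] by simp
next
  case (update f k c)
  \<comment> \<open>\<open>k\<close> lies outside the support of \<open>f\<close>, so overwriting
    the value there amounts to adding a monomial.\<close>
  have "Poly_Mapping.update k c f = f + Poly_Mapping.single k c"
    using update(1) by (intro poly_mapping_eqI) (auto simp: lookup_update lookup_add lookup_single when_def in_keys_iff)
  then show ?case using assms update(3) by simp
qed

lemma free_scalar_commutes: "free_scalar c * f = f * free_scalar c"
  by (induction f rule: poly_mapping_add_single_induct)
    (simp_all add: free_scalar_def mult_single mult.commute algebra_simps)

lemma hg2_cong_refl: "hg2_cong x x"
  by (simp add: hg2_cong_def hg2_ideal.zero)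

lemma hg2_scalar_add: "hg2_scalar (c + d) = hg2_scalar c + hg2_scalar d"
  by transfer (simp add: free_scalar_def single_add hg2_cong_refl)

lemma hg2_scalar_minus: "hg2_scalar (- c) = - hg2_scalar c"
  by transfer (simp add: free_scalar_def single_uminus hg2_cong_refl)

lemma hg2_scalar_diff: "hg2_scalar (c - d) = hg2_scalar c - hg2_scalar d"
  by transfer (simp add: free_scalar_def single_diff hg2_cong_refl)

lemma hg2_scalar_mult: "hg2_scalar (c * d) = hg2_scalar c * hg2_scalar d"
  by transfer (simp add: free_scalar_def mult_single hg2_cong_refl)

lemma hg2_scalar_one: "hg2_scalar 1 = 1"
  by transfer (simp add: free_scalar_def hg2_cong_refl)

lemma hg2_scalar_zero: "hg2_scalar 0 = 0"
  by transfer (simp add: free_scalar_def hg2_cong_refl)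

lemma hg2_scalar_commutes: "x * hg2_scalar c = hg2_scalar c * x"
  by transfer (simp add: free_scalar_commutes hg2_cong_refl)

lemma hg2_scalar_left_commutes: "x * (hg2_scalar c * y) = hg2_scalar c * (x * y)"
  by (metis hg2_scalar_commutes mult.assoc)

text \<open>Every element is the class of a sum of monomials, and a monomial arises from a scalar by
  multiplying with one letter at a time.\<close>

lemma hg2_induct [case_names scalar T1 T2 add mult]:
  assumes scalar: "\<And>c. P (hg2_scalar c)" and "P T1" and "P T2"
    and add: "\<And>x y. P x \<Longrightarrow> P y \<Longrightarrow> P (x + y)"
    and mult: "\<And>x y. P x \<Longrightarrow> P y \<Longrightarrow> P (x * y)"
  shows "P h"
proof -
  obtain f where h: "h = abs_hg2 f"
    by (metis Quotient_hg2 Quotient_abs_rep)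
  have word: "P (abs_hg2 (Poly_Mapping.single (Word ws) c))" for ws c
  proof (induction ws)
    case Nil
    show ?case using scalar[of c] by (simp add: hg2_scalar.abs_eq free_scalar_def zero_gword_def)
  next
    case (Cons g ws)
    have "P (abs_hg2 (Poly_Mapping.single (Word [g]) 1))"
      using assms(2,3) by (cases g) (simp_all add: T1.abs_eq T2.abs_eq X1_def X2_def)
    from mult[OF this Cons.IH] show ?case by (simp add: times_hg2.abs_eq mult_single)
  qed
  have "P (abs_hg2 f)"
  proof (induction f rule: poly_mapping_add_single_induct)
    case (single k c)
    then show ?case using word by (cases k) simp
  next
    case (add f g)
    then show ?case using assms(4)[OF add] by (simp add: plus_hg2.abs_eq)
  qed
  then show ?thesis by (simp add: h)
qed

section \<open>Quasi-idempotent generators\<close>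

definition E1 :: hg2 where "E1 = T1 + hg2_scalar (inverse p_ind)"
definition E2 :: hg2 where "E2 = T2 + hg2_scalar (inverse q_ind)"

lemma p_ind_nonzero: "p_ind \<noteq> 0"
  by (simp add: p_ind_def Zero_fract_def eq_fract)

lemma q_ind_nonzero: "q_ind \<noteq> 0"
  by (simp add: q_ind_def Zero_fract_def eq_fract)

text \<open>A separate symbol for the scalar action lets rewriting pull coefficients to the front of
  noncommutative words instead of treating them as further factors.\<close>

definition hg2_smult :: "Cpq \<Rightarrow> hg2 \<Rightarrow> hg2" (infixr "\<star>" 73) where
  "c \<star> x = hg2_scalar c * x"

lemma hg2_smult_simps:
  "c \<star> (x + y) = c \<star> x + c \<star> y"
  "c \<star> (x - y) = c \<star> x - c \<star> y"
  "c \<star> (- x) = - (c \<star> x)"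
  "(c + d) \<star> x = c \<star> x + d \<star> x"
  "(c - d) \<star> x = c \<star> x - d \<star> x"
  "(- c) \<star> x = - (c \<star> x)"
  "c \<star> d \<star> x = (c * d) \<star> x"
  "x * c \<star> y = c \<star> (x * y)"
  "(c \<star> x) * y = c \<star> (x * y)"
  "1 \<star> x = x"
  "0 \<star> x = 0"
  "c \<star> 0 = 0"
  by (simp_all add: hg2_smult_def ring_distribs hg2_scalar_add hg2_scalar_diff hg2_scalar_minus
      hg2_scalar_one hg2_scalar_zero)
    (simp_all add: mult.assoc hg2_scalar_mult hg2_scalar_left_commutes[of x])

lemma T1_eq: "T1 = E1 - inverse p_ind \<star> 1"
  by (simp add: E1_def hg2_smult_def)

lemma T2_eq: "T2 = E2 - inverse q_ind \<star> 1"
  by (simp add: E2_def hg2_smult_def)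

text \<open>The quadratic relation factors as (t - c)(t + c^-1) = 0, and t - c is e - (c +
  c^-1).\<close>

lemma quasi_idempotent_shift:
  fixes c :: Cpq
  assumes "c \<noteq> 0" and "t ^ 2 = hg2_scalar (c - inverse c) * t + 1"
    and e: "e = t + hg2_scalar (inverse c)"
  shows "e * e = (c + inverse c) \<star> e"
proof -
  have t: "t * t = (c - inverse c) \<star> t + 1 \<star> 1"
    using assms(2) by (simp add: power2_eq_square hg2_smult_def hg2_scalar_one)
  have e': "e = t + inverse c \<star> 1"
    by (simp add: e hg2_smult_def)
  show ?thesis
    unfolding e' using \<open>c \<noteq> 0\<close>
    by (simp add: hg2_smult_simps(1-9) ring_distribs t)
qed

lemma E1_square: "E1 * E1 = (p_ind + inverse p_ind) \<star> E1"
  by (rule quasi_idempotent_shift[OF p_ind_nonzero hg2_quadratic1 E1_def])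

lemma E2_square: "E2 * E2 = (q_ind + inverse q_ind) \<star> E2"
  by (rule quasi_idempotent_shift[OF q_ind_nonzero hg2_quadratic2 E2_def])

text \<open>The braid relation says that \<open>M = y x y x y\<close> commutes with \<open>x\<close>, hence with \<open>e\<close>; the identity is the
  expansion of \<open>e M - M e\<close>.\<close>

lemma braid_in_quasi_idempotents:
  fixes e f :: hg2 and P Q \<delta> \<epsilon> :: Cpq
  assumes ee: "e * e = \<delta> \<star> e" and ff: "f * f = \<epsilon> \<star> f"
  defines "x \<equiv> e - P \<star> 1" and "y \<equiv> f - Q \<star> 1"
  assumes "x * y * x * y * x * y = y * x * y * x * y * x"
  shows "(e * f * e * f * e * f - f * e * f * e * f * e)
    - (2 * (Q * (\<delta> - P) + P * (\<epsilon> - Q))) \<star> (e * f * e * f - f * e * f * e)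
    + (P * P * \<epsilon> * (\<epsilon> - Q) + Q * (P * \<delta> * \<epsilon> - (2 * P * Q - Q * \<delta>) * \<delta> - 2 * P * P * (\<epsilon> - Q))
        + Q * Q * P * (P - \<delta>)) \<star> (e * f - f * e) = 0"
proof -
  have ee': "e * (e * h) = \<delta> \<star> (e * h)" for h
    using ee by (metis hg2_smult_simps(9) mult.assoc)
  have ff': "f * (f * h) = \<epsilon> \<star> (f * h)" for h
    using ff by (metis hg2_smult_simps(9) mult.assoc)
  \<comment> \<open>Named coefficients stay opaque while words are expanded; they are unfolded only
    where coefficients themselves are compared.\<close>
  define r t m where "r = 2 * P * Q - Q * \<delta>" and "t = P * P" and "m = P * P * Q"
  define N where "N = x * y * x"
  have "N = e * (f * e) - P \<star> (e * f) - P \<star> (f * e) + (P * Q) \<star> e + (P * Q - Q * \<delta>) \<star> e + t \<star> f - m \<star> 1"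
    unfolding N_def x_def y_def t_def m_def
    by (simp add: algebra_simps hg2_smult_simps ee ff ee' ff')
  moreover have "r \<star> e = (P * Q) \<star> e + (P * Q - Q * \<delta>) \<star> e"
    by (simp add: r_def mult.assoc flip: hg2_smult_simps(4))
  ultimately have N: "N = e * (f * e) - P \<star> (e * f) - P \<star> (f * e) + r \<star> e + t \<star> f - m \<star> 1"
    by (simp add: add.assoc diff_add_eq)
  define l1 l2 l3 l4 k where "l1 = r - P * \<epsilon> + P * Q" and "l2 = P * Q" and "l3 = r * Q"
    and "l4 = m * Q" and "k = t * \<epsilon> - m - t * Q"
  define L where "L = N * y"
  have L: "L = e * (f * (e * f)) - P \<star> (f * (e * f)) + l1 \<star> (e * f) - Q \<star> (e * (f * e))
     + l2 \<star> (f * e) - l3 \<star> e + k \<star> f + l4 \<star> 1"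
    unfolding L_def N y_def l1_def l2_def l3_def l4_def k_def
    by (simp add: algebra_simps hg2_smult_simps ff ff')
  define M where "M = y * L"
  have "e * M - M * e = (e * (f * (e * (f * (e * f)))) - f * (e * (f * (e * (f * e)))))
    + (l1 - P * \<epsilon> + Q * P - Q * \<delta>) \<star> (e * (f * (e * f)) - f * (e * (f * e)))
    + (k * \<epsilon> + l4 - Q * k) \<star> (e * f - f * e)
    + (- Q * l1) \<star> (\<delta> \<star> (e * f) - e * (f * e)) + (l2 * \<epsilon> - l3 - Q * l2) \<star> (e * (f * e) - \<delta> \<star> (f * e))"
    unfolding M_def L y_def by (simp add: algebra_simps hg2_smult_simps ee ff ee' ff')
  \<comment> \<open>Because these two coefficients agree, the words \<open>e * (f * e)\<close> of
    odd length cancel and only differences of alternating words of even length remain.\<close>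
  moreover have "l2 * \<epsilon> - l3 - Q * l2 = - Q * l1"
    by (simp add: l1_def l2_def l3_def algebra_simps)
  moreover have "c \<star> (\<delta> \<star> (e * f) - e * (f * e)) + c \<star> (e * (f * e) - \<delta> \<star> (f * e)) = (c * \<delta>) \<star> (e * f - f * e)" for c
    by (simp add: hg2_smult_simps)
  moreover have "e * M = M * e"
    using assms(5) by (simp add: M_def L_def N_def x_def algebra_simps hg2_smult_simps)
  ultimately have "(e * (f * (e * (f * (e * f)))) - f * (e * (f * (e * (f * e)))))
    + (l1 - P * \<epsilon> + Q * P - Q * \<delta>) \<star> (e * (f * (e * f)) - f * (e * (f * e)))
    + (k * \<epsilon> + l4 - Q * k) \<star> (e * f - f * e) + (- Q * l1 * \<delta>) \<star> (e * f - f * e) = 0"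
    by (metis (no_types, lifting) add.assoc cancel_comm_monoid_add_class.diff_cancel)
  then show ?thesis
    unfolding l1_def l4_def k_def r_def t_def m_def
    by (simp add: hg2_smult_simps algebra_simps)
qed

text \<open>In a two-dimensional representation where \<open>T1\<close> has trace p - p^-1 and
  \<open>T2\<close> has trace q - q^-1, expanding \<open>E1 * E2\<close> shows that its trace
  exceeds that of \<open>T1 * T2\<close> by exactly this amount.\<close>

definition ratio_sum :: Cpq where
  "ratio_sum = p_ind / q_ind + q_ind / p_ind"

text \<open>This is the last coefficient of the braid identity at \<delta> = p + P and \<epsilon> =
  q + Q; the factorization of s^2 - 1 later supplies the two eigenvalues. Over an arbitrary field p
  and q are plain variables, so field arithmetic applies directly.\<close>

lemma braid_coefficient:
  fixes p q :: "'a :: field"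
  assumes "p \<noteq> 0" "q \<noteq> 0"
  defines "P \<equiv> inverse p" and "Q \<equiv> inverse q"
  shows "P * P * (q + Q) * (q + Q - Q)
      + Q * (P * (p + P) * (q + Q) - (2 * P * Q - Q * (p + P)) * (p + P) - 2 * P * P * (q + Q - Q))
      + Q * Q * P * (P - (p + P)) = (p * Q + q * P)\<^sup>2 - 1"
  using assms(1,2) unfolding P_def Q_def by (simp add: field_simps power2_eq_square)

lemma E1_E2_relation:
  "E1 * E2 * E1 * E2 * E1 * E2 + (- 2 * ratio_sum) \<star> (E1 * E2 * E1 * E2) + (ratio_sum\<^sup>2 - 1) \<star> (E1 * E2) =
   E2 * E1 * E2 * E1 * E2 * E1 + (- 2 * ratio_sum) \<star> (E2 * E1 * E2 * E1) + (ratio_sum\<^sup>2 - 1) \<star> (E2 * E1)"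
proof -
  have s: "ratio_sum = p_ind * inverse q_ind + q_ind * inverse p_ind"
    by (simp add: ratio_sum_def divide_inverse)
  note braid_in_quasi_idempotents[OF E1_square E2_square hg2_braid[unfolded T1_eq T2_eq]]
  also have "2 * (inverse q_ind * (p_ind + inverse p_ind - inverse p_ind) + inverse p_ind * (q_ind + inverse q_ind - inverse q_ind))
      = 2 * ratio_sum"
    by (simp add: s)
  also note braid_coefficient[OF p_ind_nonzero q_ind_nonzero, folded s]
  finally show ?thesis
    using p_ind_nonzero q_ind_nonzero
    by (simp add: algebra_simps hg2_smult_simps)
qed

definition braid_elt :: hg2 where
  "braid_elt = E1 * E2 * E1 * E2 * E1 * E2 + (- 2 * ratio_sum) \<star> (E1 * E2 * E1 * E2) + (ratio_sum\<^sup>2 - 1) \<star> (E1 * E2)"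

lemma E1_braid_elt: "E1 * braid_elt = (p_ind + inverse p_ind) \<star> braid_elt"
proof -
  have "E1 * (E1 * x) = (p_ind + inverse p_ind) \<star> (E1 * x)" for x
    by (metis E1_square hg2_smult_simps(9) mult.assoc)
  then show ?thesis
    by (simp add: braid_elt_def distrib_left mult.assoc hg2_smult_simps(1,7,8) mult.commute)
qed

text \<open>\<open>E1_E2_relation\<close> rewrites the element so that every word begins with
  \<open>E2\<close>, which then absorbs a further factor \<open>E2\<close>.\<close>

lemma E2_braid_elt: "E2 * braid_elt = (q_ind + inverse q_ind) \<star> braid_elt"
proof -
  have "E2 * (E2 * x) = (q_ind + inverse q_ind) \<star> (E2 * x)" for x
    by (metis E2_square hg2_smult_simps(9) mult.assoc)
  then show ?thesis
    unfolding braid_elt_def E1_E2_relation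
    by (simp add: distrib_left mult.assoc hg2_smult_simps(1,7,8) mult.commute)
qed

section \<open>Modules and Schur's lemma\<close>

lemma subspace_Kvec_iff:
  "VectorSpace.subspace class_ring W (Kvec n) \<longleftrightarrow>
     W \<subseteq> carrier_vec n \<and> 0\<^sub>v n \<in> W \<and> (\<forall>v\<in>W. \<forall>w\<in>W. v + w \<in> W) \<and> (\<forall>c. \<forall>v\<in>W. c \<cdot>\<^sub>v v \<in> W)"
  using vec_vs[where ?'a = Cpq and n = n] vec_module[where ?'a = Cpq and n = n]
  by (auto simp: VectorSpace.subspace_def LinearCombinations.submodule_def module_vec_simps class_ring_simps)

lemma subspace_line:
  assumes v: "v \<in> carrier_vec n"
  shows "VectorSpace.subspace class_ring (range (\<lambda>c. c \<cdot>\<^sub>v v)) (Kvec n)"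
  unfolding subspace_Kvec_iff
proof (intro conjI ballI allI)
  show "0\<^sub>v n \<in> range (\<lambda>c. c \<cdot>\<^sub>v v)" using v by (intro image_eqI[of _ _ 0]) auto
qed (use v in \<open>auto simp: smult_smult_assoc simp flip: add_smult_distrib_vec\<close>)

lemma span_singleton_Kvec:
  assumes v: "v \<in> carrier_vec n"
  shows "LinearCombinations.module.span class_ring (Kvec n) {v} = range (\<lambda>c. c \<cdot>\<^sub>v v)" (is "?S = ?R")
proof -
  interpret vec_space "TYPE(Cpq)" n .
  have "VectorSpace.subspace class_ring ?R (Kvec n)"
    using v by (rule subspace_line)
  moreover have "v \<in> ?R"
    by (rule range_eqI[of _ _ 1]) simp
  ultimately have "?S \<subseteq> ?R"
    by (intro span_is_subset) (simp_all only: VectorSpace.subspace_def empty_subsetI insert_subset)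
  moreover have "?R \<subseteq> ?S"
    using v in_own_span[of "{v}"] by (auto intro: smult_in_span)
  ultimately show ?thesis by blast
qed

lemma smult_mat_mult_vec:
  "A \<in> carrier_mat nr nc \<Longrightarrow> v \<in> carrier_vec nc \<Longrightarrow> (c \<cdot>\<^sub>m A) *\<^sub>v v = c \<cdot>\<^sub>v (A *\<^sub>v v)"
  for A :: "'a :: comm_semiring_0 mat"
  by (intro eq_vecI) (auto simp: smult_scalar_prod_distrib[of _ nc])

locale hg2_module =
  fixes n :: nat and \<rho> :: "hg2 \<Rightarrow> Cpq mat"
  assumes rep: "hg2_rep n \<rho>"
begin

lemma rep_carrier [simp]: "\<rho> h \<in> carrier_mat n n"
  using rep by (simp add: hg2_rep_def)

lemma rep_dims [simp]: "dim_row (\<rho> h) = n" "dim_col (\<rho> h) = n"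
  using rep_carrier[of h] by blast+

lemma rep_add: "\<rho> (h + k) = \<rho> h + \<rho> k"
  and rep_mult: "\<rho> (h * k) = \<rho> h * \<rho> k"
  and rep_one: "\<rho> 1 = 1\<^sub>m n"
  and rep_smult: "\<rho> (c \<star> h) = c \<cdot>\<^sub>m \<rho> h"
  using rep unfolding hg2_rep_def hg2_smult_def by blast+

lemma rep_scalar: "\<rho> (hg2_scalar c) = c \<cdot>\<^sub>m 1\<^sub>m n"
  using rep_smult[of c 1] by (simp add: hg2_smult_def rep_one)

lemma act_carrier [simp]: "v \<in> carrier_vec n \<Longrightarrow> \<rho> h *\<^sub>v v \<in> carrier_vec n"
  by (rule mult_mat_vec_carrier[OF rep_carrier])

lemma act_simps:
  assumes "v \<in> carrier_vec n"
  shows "\<rho> (h + k) *\<^sub>v v = \<rho> h *\<^sub>v v + \<rho> k *\<^sub>v v"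
    and "\<rho> (h * k) *\<^sub>v v = \<rho> h *\<^sub>v (\<rho> k *\<^sub>v v)"
    and "\<rho> (c \<star> h) *\<^sub>v v = c \<cdot>\<^sub>v (\<rho> h *\<^sub>v v)"
    and "\<rho> (hg2_scalar c) *\<^sub>v v = c \<cdot>\<^sub>v v"
    and "\<rho> h *\<^sub>v (c \<cdot>\<^sub>v v) = c \<cdot>\<^sub>v (\<rho> h *\<^sub>v v)"
  using assms
  by (simp_all add: rep_add rep_mult rep_smult rep_scalar add_mult_distrib_mat_vec[where nr = n and nc = n]
      assoc_mult_mat_vec[where n\<^sub>1 = n and n\<^sub>2 = n and n\<^sub>3 = n] mult_mat_vec[where nr = n and nc = n]
      smult_mat_mult_vec[where nr = n and nc = n])

lemma act_vec_add:
  "v \<in> carrier_vec n \<Longrightarrow> w \<in> carrier_vec n \<Longrightarrow> \<rho> h *\<^sub>v (v + w) = \<rho> h *\<^sub>v v + \<rho> h *\<^sub>v w"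
  by (rule mult_add_distrib_mat_vec[OF rep_carrier])

lemma act_zero [simp]: "\<rho> h *\<^sub>v 0\<^sub>v n = 0\<^sub>v n"
  using carrier_matD[OF rep_carrier[of h]] by (intro eq_vecI) auto

text \<open>The elements that \<open>Q\<close> intertwines contain the scalars and are closed under
  sums and products, so the two generators decide.\<close>

lemma intertwinerI:
  assumes "hg2_module m \<sigma>" and Q: "Q \<in> carrier_mat n m"
    and "\<rho> T1 * Q = Q * \<sigma> T1" and "\<rho> T2 * Q = Q * \<sigma> T2"
  shows "\<rho> h * Q = Q * \<sigma> h"
proof -
  interpret \<sigma>: hg2_module m \<sigma> by fact
  show ?thesis
  proof (induction h rule: hg2_induct)
    case (scalar c)
    show ?case using Q
      by (simp add: rep_scalar \<sigma>.rep_scalar mult_smult_assoc_mat[where nr = n and n = n and nc = m]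
          mult_smult_distrib[where nr = n and n = m and nc = m])
  next
    case (add x y)
    then show ?case using Q
      by (simp add: rep_add \<sigma>.rep_add add_mult_distrib_mat[of _ n n _ _ m]
          mult_add_distrib_mat[of _ n m _ m])
  next
    case (mult x y)
    have "\<rho> (x * y) * Q = \<rho> x * (\<rho> y * Q)"
      unfolding rep_mult by (rule assoc_mult_mat[OF rep_carrier rep_carrier Q])
    also have "\<dots> = (\<rho> x * Q) * \<sigma> y"
      using Q by (simp add: mult(2) assoc_mult_mat[of _ n n _ m _ m])
    also have "\<dots> = Q * \<sigma> (x * y)"
      using Q by (simp add: mult(1) \<sigma>.rep_mult assoc_mult_mat[of _ n m _ m _ m])
    finally show ?case .
  qed (use assms in auto)
qed

end

section \<open>Traces, and Schur's lemma for nonzero intertwiners\<close>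

lemma of_nat_Cpq_inject: "(of_nat m :: Cpq) = of_nat n \<longleftrightarrow> m = n"
  by (simp add: of_nat_fract eq_fract)

definition trace_mat :: "'a :: comm_monoid_add mat \<Rightarrow> 'a" where
  "trace_mat A = (\<Sum>i<dim_row A. A $$ (i, i))"

lemma trace_mat_mult_commute:
  fixes Q R :: "'a :: comm_semiring_0 mat"
  assumes "Q \<in> carrier_mat n m" "R \<in> carrier_mat m n"
  shows "trace_mat (Q * R) = trace_mat (R * Q)"
proof -
  have "trace_mat (Q * R) = (\<Sum>i<n. \<Sum>j<m. Q $$ (i, j) * R $$ (j, i))"
    using assms by (auto simp: trace_mat_def scalar_prod_def lessThan_atLeast0 intro!: sum.cong)
  also have "\<dots> = (\<Sum>j<m. \<Sum>i<n. R $$ (j, i) * Q $$ (i, j))"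
    by (subst sum.swap) (simp add: mult.commute)
  also have "\<dots> = trace_mat (R * Q)"
    using assms by (auto simp: trace_mat_def scalar_prod_def lessThan_atLeast0 intro!: sum.cong)
  finally show ?thesis .
qed

text \<open>The products in both orders have equal trace, and in characteristic zero the trace of an
  identity matrix determines its size.\<close>

lemma mat_inverse_dims_eq:
  fixes Q R :: "Cpq mat"
  assumes "Q \<in> carrier_mat n m" "R \<in> carrier_mat m n" "Q * R = 1\<^sub>m n" "R * Q = 1\<^sub>m m"
  shows "n = m"
proof -
  have "(of_nat n :: Cpq) = trace_mat (Q * R)" "trace_mat (R * Q) = (of_nat m :: Cpq)"
    using assms(3,4) by (simp_all add: trace_mat_def)
  then show ?thesis
    using trace_mat_mult_commute[OF assms(1,2)] by (simp add: of_nat_Cpq_inject)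
qed

text \<open>Kernel and image of \<open>Q\<close> are invariant, hence trivial and everything
  respectively. The sizes \<open>n\<close> and \<open>m\<close> are not known to agree beforehand: a
  two-sided inverse is built first, and its existence forces \<open>n = m\<close>.\<close>

lemma Schur_lemma:
  assumes \<sigma>: "irreducible_rep m \<sigma>" and \<tau>: "irreducible_rep n \<tau>"
    and Q: "Q \<in> carrier_mat n m" and nz: "Q \<noteq> 0\<^sub>m n m"
    and comm: "\<And>h. \<tau> h * Q = Q * \<sigma> h"
  shows "n = m \<and> (\<exists>R \<in> carrier_mat m n. Q * R = 1\<^sub>m n \<and> R * Q = 1\<^sub>m m)"
proof -
  interpret \<sigma>: hg2_module m \<sigma> using \<sigma> by (simp add: irreducible_rep_def hg2_module_def)
  interpret \<tau>: hg2_module n \<tau> using \<tau> by (simp add: irreducible_rep_def hg2_module_def)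
  have Qv: "Q *\<^sub>v v \<in> carrier_vec n" if "v \<in> carrier_vec m" for v
    using Q that by simp
  have commv: "\<tau> h *\<^sub>v (Q *\<^sub>v v) = Q *\<^sub>v (\<sigma> h *\<^sub>v v)" if "v \<in> carrier_vec m" for h v
  proof -
    have "\<tau> h *\<^sub>v (Q *\<^sub>v v) = (\<tau> h * Q) *\<^sub>v v"
      by (rule assoc_mult_mat_vec[symmetric, OF \<tau>.rep_carrier Q that])
    also have "\<dots> = Q *\<^sub>v (\<sigma> h *\<^sub>v v)"
      unfolding comm by (rule assoc_mult_mat_vec[OF Q \<sigma>.rep_carrier that])
    finally show ?thesis .
  qed
  have Qadd: "Q *\<^sub>v (v + w) = Q *\<^sub>v v + Q *\<^sub>v w" if "v \<in> carrier_vec m" "w \<in> carrier_vec m" for v w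
    using Q that by (rule mult_add_distrib_mat_vec)
  have Qsmult: "Q *\<^sub>v (c \<cdot>\<^sub>v v) = c \<cdot>\<^sub>v (Q *\<^sub>v v)" if "v \<in> carrier_vec m" for c v
    using Q that by (rule mult_mat_vec)
  \<comment> \<open>One nonzero column shows both that the kernel is proper and that the image is
    nonzero.\<close>
  obtain k where k: "k < m" "Q *\<^sub>v unit_vec m k \<noteq> 0\<^sub>v n"
  proof -
    have "\<not> (\<forall>i<n. \<forall>j<m. Q $$ (i, j) = 0)"
    proof
      assume "\<forall>i<n. \<forall>j<m. Q $$ (i, j) = 0"
      then have "Q = 0\<^sub>m n m" using Q by (intro eq_matI) auto
      with nz show False ..
    qed
    then obtain i j where ij: "i < n" "j < m" "Q $$ (i, j) \<noteq> 0" by blast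
    then have "(Q *\<^sub>v unit_vec m j) $ i \<noteq> 0" using Q by simp
    then have "Q *\<^sub>v unit_vec m j \<noteq> 0\<^sub>v n" using ij by auto
    then show ?thesis using that ij by blast
  qed
  have "invariant_subspace m \<sigma> UNIV {v \<in> carrier_vec m. Q *\<^sub>v v = 0\<^sub>v n}"
    using Q by (auto simp: invariant_subspace_def subspace_Kvec_iff Qadd Qsmult simp flip: commv)
  moreover have "{v \<in> carrier_vec m. Q *\<^sub>v v = 0\<^sub>v n} \<noteq> carrier_vec m"
    using k unit_vec_carrier by blast
  ultimately have "{v \<in> carrier_vec m. Q *\<^sub>v v = 0\<^sub>v n} = {0\<^sub>v m}"
    using \<sigma> unfolding irreducible_rep_def irreducible_subspace_def by blast
  then have inj: "v = 0\<^sub>v m" if "v \<in> carrier_vec m" "Q *\<^sub>v v = 0\<^sub>v n" for v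
    using that by blast
  have "invariant_subspace n \<tau> UNIV ((*\<^sub>v) Q ` carrier_vec m)"
    unfolding invariant_subspace_def subspace_Kvec_iff
  proof (intro conjI ballI allI)
    show "0\<^sub>v n \<in> (*\<^sub>v) Q ` carrier_vec m"
      using Q by (intro image_eqI[of _ _ "0\<^sub>v m"]) auto
  qed (auto simp: Qv commv simp flip: Qadd Qsmult)
  moreover have "(*\<^sub>v) Q ` carrier_vec m \<noteq> {0\<^sub>v n}"
    using k unit_vec_carrier by blast
  moreover have "(*\<^sub>v) Q ` carrier_vec m \<subseteq> carrier_vec n"
    using Qv by blast
  ultimately have surj: "(*\<^sub>v) Q ` carrier_vec m = carrier_vec n"
    using \<tau> unfolding irreducible_rep_def irreducible_subspace_def by blast
  \<comment> \<open>Preimages of the unit vectors serve as the columns of a right inverse.\<close>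
  have "\<exists>v. v \<in> carrier_vec m \<and> Q *\<^sub>v v = unit_vec n i" for i
  proof -
    have "unit_vec n i \<in> (*\<^sub>v) Q ` carrier_vec m"
      unfolding surj by (rule unit_vec_carrier)
    then show ?thesis by (metis imageE)
  qed
  then obtain r where r: "\<And>i. r i \<in> carrier_vec m" "\<And>i. Q *\<^sub>v r i = unit_vec n i"
    by metis
  define R where "R = mat_of_cols m (map r [0..<n])"
  have R: "R \<in> carrier_mat m n" by (simp add: R_def carrier_matI)
  have colR: "col R j = r j" if "j < n" for j
    using that r(1)[of j] unfolding R_def by simp
  have QR: "Q * R = 1\<^sub>m n"
  proof (rule eq_matI)
    fix i j assume ij: "i < dim_row (1\<^sub>m n)" "j < dim_col (1\<^sub>m n)"
    then have "(Q * R) $$ (i, j) = (Q *\<^sub>v r j) $ i"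
      using Q R colR by simp
    then show "(Q * R) $$ (i, j) = 1\<^sub>m n $$ (i, j)"
      using ij r(2) by simp
  qed (use Q R in auto)
  have RQ: "R * Q = 1\<^sub>m m"
  proof -
    \<comment> \<open>Since \<open>Q * R\<close> is the identity, \<open>Q\<close> kills R*Q - 1,
      and injectivity applies column by column.\<close>
    have "col (R * Q - 1\<^sub>m m) j = 0\<^sub>v m" if j: "j < m" for j
    proof (rule inj)
      show "col (R * Q - 1\<^sub>m m) j \<in> carrier_vec m" using R Q by (simp add: carrier_vecI)
      have "Q * (R * Q - 1\<^sub>m m) = Q * (R * Q) - Q * 1\<^sub>m m"
        using Q R by (intro mult_minus_distrib_mat) auto
      also have "Q * (R * Q) = Q"
        using Q R QR by (metis assoc_mult_mat left_mult_one_mat)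
      finally have z: "Q * (R * Q - 1\<^sub>m m) = 0\<^sub>m n m" using Q by simp
      have "Q *\<^sub>v col (R * Q - 1\<^sub>m m) j = col (Q * (R * Q - 1\<^sub>m m)) j"
        using Q R j by (intro eq_vecI) auto
      then show "Q *\<^sub>v col (R * Q - 1\<^sub>m m) j = 0\<^sub>v n" using z j by simp
    qed
    then have "(R * Q - 1\<^sub>m m) $$ (i, j) = 0" if "i < m" "j < m" for i j
    proof -
      have "(R * Q - 1\<^sub>m m) $$ (i, j) = col (R * Q - 1\<^sub>m m) j $ i"
        using that R Q by simp
      also have "\<dots> = 0" using that \<open>\<And>j. j < m \<Longrightarrow> col (R * Q - 1\<^sub>m m) j = 0\<^sub>v m\<close>[of j] by simp
      finally show ?thesis .
    qed
    then have entry: "(R * Q) $$ (i, j) - 1\<^sub>m m $$ (i, j) = 0" if "i < m" "j < m" for i j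
      using that R Q by (metis carrier_matD index_minus_mat(1) one_carrier_mat)
    show ?thesis using R Q entry by (intro eq_matI) (simp_all only: carrier_matD index_mult_mat(2,3) index_one_mat(2,3) right_minus_eq)
  qed
  show ?thesis using mat_inverse_dims_eq[OF Q R QR RQ] R QR RQ by blast
qed

section \<open>Eigenvectors of the quasi-idempotents on an arbitrary module\<close>

context hg2_module
begin

text \<open>The hypothesis reads (h - \<mu>)(h - \<kappa>) v = 0: either the inner factor already
  kills \<open>v\<close>, or its value is an eigenvector for \<mu>.\<close>

lemma two_step_eigenvector:
  fixes h :: hg2
  assumes v: "v \<in> carrier_vec n" "v \<noteq> 0\<^sub>v n"
    and sq: "\<rho> h *\<^sub>v (\<rho> h *\<^sub>v v) + (- (\<kappa> + \<mu>)) \<cdot>\<^sub>v (\<rho> h *\<^sub>v v) + (\<kappa> * \<mu>) \<cdot>\<^sub>v v = 0\<^sub>v n"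
  obtains (direct) "\<rho> h *\<^sub>v v = \<kappa> \<cdot>\<^sub>v v"
    | (shifted) w where "w = \<rho> h *\<^sub>v v + (- \<kappa>) \<cdot>\<^sub>v v" "w \<noteq> 0\<^sub>v n" "\<rho> h *\<^sub>v w = \<mu> \<cdot>\<^sub>v w"
proof -
  define w where "w = \<rho> h *\<^sub>v v + (- \<kappa>) \<cdot>\<^sub>v v"
  \<comment> \<open>Passing to entries turns the vector equation into an identity in the field,
    where ring normalization applies.\<close>
  have comp: "(\<rho> h *\<^sub>v (\<rho> h *\<^sub>v v)) $ i + - (\<kappa> + \<mu>) * (\<rho> h *\<^sub>v v) $ i + \<kappa> * \<mu> * v $ i = 0" if "i < n" for i
    using arg_cong[OF sq, of "\<lambda>u. u $ i"] that v carrier_vecD[OF act_carrier[OF v(1)]]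
      carrier_vecD[OF act_carrier[OF act_carrier[OF v(1)]]] by (simp del: index_mult_mat_vec)
  have "\<rho> h *\<^sub>v w = \<rho> h *\<^sub>v (\<rho> h *\<^sub>v v) + (- \<kappa>) \<cdot>\<^sub>v (\<rho> h *\<^sub>v v)"
    using v unfolding w_def by (simp add: act_vec_add act_simps)
  also have "\<dots> = \<mu> \<cdot>\<^sub>v w"
  proof (rule eq_vecI)
    fix i assume "i < dim_vec (\<mu> \<cdot>\<^sub>v w)"
    then have i: "i < n" using v by (simp add: w_def)
    have "(\<rho> h *\<^sub>v (\<rho> h *\<^sub>v v)) $ i + - \<kappa> * (\<rho> h *\<^sub>v v) $ i = \<mu> * ((\<rho> h *\<^sub>v v) $ i + - \<kappa> * v $ i)"
    proof -
      have "(\<rho> h *\<^sub>v (\<rho> h *\<^sub>v v)) $ i + - \<kappa> * (\<rho> h *\<^sub>v v) $ i - \<mu> * ((\<rho> h *\<^sub>v v) $ i + - \<kappa> * v $ i)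
          = (\<rho> h *\<^sub>v (\<rho> h *\<^sub>v v)) $ i + - (\<kappa> + \<mu>) * (\<rho> h *\<^sub>v v) $ i + \<kappa> * \<mu> * v $ i"
        by (simp add: algebra_simps del: index_mult_mat_vec)
      then show ?thesis using comp[OF i] by (metis right_minus_eq)
    qed
    then show "(\<rho> h *\<^sub>v (\<rho> h *\<^sub>v v) + (- \<kappa>) \<cdot>\<^sub>v (\<rho> h *\<^sub>v v)) $ i = (\<mu> \<cdot>\<^sub>v w) $ i"
      using i v carrier_vecD[OF act_carrier[OF v(1)]] carrier_vecD[OF act_carrier[OF act_carrier[OF v(1)]]]
      by (simp add: w_def del: index_mult_mat_vec)
  qed (use v in \<open>simp add: w_def\<close>)
  finally have hw: "\<rho> h *\<^sub>v w = \<mu> \<cdot>\<^sub>v w" .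
  show ?thesis
  proof (cases "w = 0\<^sub>v n")
    case True
    have "\<rho> h *\<^sub>v v = \<kappa> \<cdot>\<^sub>v v"
    proof (rule eq_vecI)
      fix i assume "i < dim_vec (\<kappa> \<cdot>\<^sub>v v)"
      then show "(\<rho> h *\<^sub>v v) $ i = (\<kappa> \<cdot>\<^sub>v v) $ i"
        using arg_cong[OF True, of "\<lambda>u. u $ i"] v carrier_vecD[OF act_carrier[OF v(1)]]
        by (simp add: w_def del: index_mult_mat_vec)
    qed (use v in simp)
    then show ?thesis by (rule direct)
  next
    case False
    then show ?thesis using shifted hw w_def by blast
  qed
qed

lemma E1_E1_act: "v \<in> carrier_vec n \<Longrightarrow> \<rho> E1 *\<^sub>v (\<rho> E1 *\<^sub>v v) = (p_ind + inverse p_ind) \<cdot>\<^sub>v (\<rho> E1 *\<^sub>v v)"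
  using arg_cong[OF E1_square, of "\<lambda>h. \<rho> h *\<^sub>v v"] by (simp add: act_simps)

lemma E2_E2_act: "v \<in> carrier_vec n \<Longrightarrow> \<rho> E2 *\<^sub>v (\<rho> E2 *\<^sub>v v) = (q_ind + inverse q_ind) \<cdot>\<^sub>v (\<rho> E2 *\<^sub>v v)"
  using arg_cong[OF E2_square, of "\<lambda>h. \<rho> h *\<^sub>v v"] by (simp add: act_simps)

lemma zero_smult_carrier_vec: "v \<in> carrier_vec n \<Longrightarrow> 0 \<cdot>\<^sub>v v = 0\<^sub>v n" for v :: "Cpq vec"
  by auto

lemma eigenvector_cases:
  assumes "n \<noteq> 0"
  obtains (common) v \<alpha> \<beta> where "v \<in> carrier_vec n" "v \<noteq> 0\<^sub>v n"
      "\<alpha> \<in> {0, p_ind + inverse p_ind}" "\<beta> \<in> {0, q_ind + inverse q_ind}"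
      "\<rho> E1 *\<^sub>v v = \<alpha> \<cdot>\<^sub>v v" "\<rho> E2 *\<^sub>v v = \<beta> \<cdot>\<^sub>v v"
    | (two) v \<kappa> where "v \<in> carrier_vec n" "v \<noteq> 0\<^sub>v n" "\<kappa> \<in> {ratio_sum + 1, ratio_sum - 1}"
      "\<rho> E1 *\<^sub>v v = (p_ind + inverse p_ind) \<cdot>\<^sub>v v" "\<rho> E1 *\<^sub>v (\<rho> E2 *\<^sub>v v) = \<kappa> \<cdot>\<^sub>v v"
proof -
  let ?\<delta> = "p_ind + inverse p_ind" and ?\<epsilon> = "q_ind + inverse q_ind"
  note [simp] = E1_E1_act E2_E2_act zero_smult_carrier_vec
  define u :: "Cpq vec" where "u = unit_vec n 0"
  have u: "u \<in> carrier_vec n" "u \<noteq> 0\<^sub>v n"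
    using assms by (auto simp: u_def dest: arg_cong[of _ _ "\<lambda>v. v $ 0"])
  show thesis
  proof (cases "\<exists>v\<in>carrier_vec n. v \<noteq> 0\<^sub>v n \<and> \<rho> E1 *\<^sub>v v = ?\<delta> \<cdot>\<^sub>v v")
    case False
    \<comment> \<open>A nonzero vector in the image of \<open>E1\<close> would be an eigenvector of
      the excluded kind.\<close>
    then have E1: "\<rho> E1 *\<^sub>v v = 0\<^sub>v n" if "v \<in> carrier_vec n" for v
      using E1_E1_act act_carrier that by blast
    show thesis
    proof (cases "\<rho> E2 *\<^sub>v u = 0\<^sub>v n")
      case True
      with u E1[of u] show thesis
        by (intro common[of u 0 0]) auto
    next
      case False
      with u E1[of "\<rho> E2 *\<^sub>v u"] show thesis
        by (intro common[of "\<rho> E2 *\<^sub>v u" 0 ?\<epsilon>]) auto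
    qed
  next
    case True
    then obtain v where v: "v \<in> carrier_vec n" "v \<noteq> 0\<^sub>v n" "\<rho> E1 *\<^sub>v v = ?\<delta> \<cdot>\<^sub>v v"
      by blast
    define w where "w = \<rho> (E1 * E2) *\<^sub>v v"
    have w: "w \<in> carrier_vec n" "\<rho> E1 *\<^sub>v w = ?\<delta> \<cdot>\<^sub>v w"
      using v by (simp_all add: w_def act_simps)
    \<comment> \<open>The common eigenvectors in the first three cases are \<open>braid_elt\<close>
      applied to \<open>v\<close>, then \<open>v\<close> itself, then \<open>E2\<close> applied to
      \<open>v\<close>; in the last case \<open>w\<close> is annihilated by the two remaining linear
      factors.\<close>
    consider "\<rho> braid_elt *\<^sub>v v \<noteq> 0\<^sub>v n" | "\<rho> E2 *\<^sub>v v = 0\<^sub>v n" | "\<rho> E2 *\<^sub>v v \<noteq> 0\<^sub>v n" "w = 0\<^sub>v n"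
      | "\<rho> braid_elt *\<^sub>v v = 0\<^sub>v n" "w \<noteq> 0\<^sub>v n"
      by blast
    then show thesis
    proof cases
      case 1
      have "\<rho> E1 *\<^sub>v (\<rho> braid_elt *\<^sub>v v) = ?\<delta> \<cdot>\<^sub>v (\<rho> braid_elt *\<^sub>v v)"
        "\<rho> E2 *\<^sub>v (\<rho> braid_elt *\<^sub>v v) = ?\<epsilon> \<cdot>\<^sub>v (\<rho> braid_elt *\<^sub>v v)"
        using v arg_cong[OF E1_braid_elt, of "\<lambda>h. \<rho> h *\<^sub>v v"] arg_cong[OF E2_braid_elt, of "\<lambda>h. \<rho> h *\<^sub>v v"]
        by (simp_all add: act_simps)
      then show thesis using v 1 by (intro common[of "\<rho> braid_elt *\<^sub>v v" ?\<delta> ?\<epsilon>]) auto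
    next
      case 2
      then show thesis using v by (intro common[of v ?\<delta> 0]) auto
    next
      case 3
      then show thesis using v by (intro common[of "\<rho> E2 *\<^sub>v v" 0 ?\<epsilon>]) (auto simp: w_def act_simps)
    next
      case 4
      \<comment> \<open>The cubic \<open>braid_elt\<close> has no constant term; its factor
        \<open>E1 * E2\<close> has been spent on passing from \<open>v\<close> to
        \<open>w\<close>.\<close>
      have "\<rho> (E1 * E2) *\<^sub>v (\<rho> (E1 * E2) *\<^sub>v w) + (- ((ratio_sum + 1) + (ratio_sum - 1))) \<cdot>\<^sub>v (\<rho> (E1 * E2) *\<^sub>v w)
          + ((ratio_sum + 1) * (ratio_sum - 1)) \<cdot>\<^sub>v w = 0\<^sub>v n"
      proof -
        have "- ((ratio_sum + 1) + (ratio_sum - 1)) = - 2 * ratio_sum"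
          "(ratio_sum + 1) * (ratio_sum - 1) = ratio_sum\<^sup>2 - 1"
          by (simp_all add: power2_eq_square algebra_simps)
        then show ?thesis
          using 4(1) v unfolding braid_elt_def w_def by (simp add: act_simps mult.assoc)
      qed
      from w(1) 4(2) this show thesis
      proof (cases rule: two_step_eigenvector)
        case direct
        then show thesis using w 4 by (intro two[of w "ratio_sum + 1"]) (auto simp: act_simps)
      next
        case (shifted z)
        have "z \<in> carrier_vec n" using shifted(1) w by simp
        \<comment> \<open>\<open>z\<close> combines \<open>w\<close> with a vector in the image of
          \<open>E1\<close>, so it stays in the same eigenspace of \<open>E1\<close>.\<close>
        moreover have "\<rho> E1 *\<^sub>v z = ?\<delta> \<cdot>\<^sub>v z"
          unfolding shifted(1) using w
          by (simp add: act_vec_add act_simps smult_add_distrib_vec[of _ n] smult_smult_assoc mult.commute)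
        ultimately show thesis
          using shifted(2,3) by (intro two[of z "ratio_sum - 1"]) (auto simp: act_simps)
      qed
    qed
  qed
qed

end

section \<open>Specialization at \<open>p = q = 1\<close>\<close>

lemma specializesI:
  "poly (poly g 1) 1 \<noteq> 0 \<Longrightarrow> r = Fract f g \<Longrightarrow> c = poly (poly f 1) 1 / poly (poly g 1) 1 \<Longrightarrow>
    specializes r c"
  unfolding specializes_def by blast

lemma specializes_nonzero:
  assumes "specializes r c" "c \<noteq> 0"
  shows "r \<noteq> 0"
proof
  assume "r = 0"
  with assms(1) obtain f g where g: "poly (poly g 1) 1 \<noteq> 0" and "Fract f g = 0"
    and c: "c = poly (poly f 1) 1 / poly (poly g 1) 1"
    by (auto simp: specializes_def)
  \<comment> \<open>This excludes the default \<open>Fract f 0 = 0\<close>, where vanishing of the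
    fraction would say nothing about \<open>f\<close>.\<close>
  moreover from g have "g \<noteq> 0" by auto
  ultimately have "f = 0" by (simp add: Zero_fract_def eq_fract(1))
  with c \<open>c \<noteq> 0\<close> show False by simp
qed

lemma specializes_add:
  assumes "specializes r c" "specializes s d"
  shows "specializes (r + s) (c + d)"
proof -
  from assms obtain f g f' g' where
    *: "poly (poly g 1) 1 \<noteq> 0" "r = Fract f g" "c = poly (poly f 1) 1 / poly (poly g 1) 1"
       "poly (poly g' 1) 1 \<noteq> 0" "s = Fract f' g'" "d = poly (poly f' 1) 1 / poly (poly g' 1) 1"
    by (auto simp: specializes_def)
  then have "g \<noteq> 0" "g' \<noteq> 0" by auto
  with * show ?thesis
    by (intro specializesI[where f = "f * g' + f' * g" and g = "g * g'"]) (simp_all add: add_frac_eq)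
qed

lemma specializes_mult:
  assumes "specializes r c" "specializes s d"
  shows "specializes (r * s) (c * d)"
proof -
  from assms obtain f g f' g' where
    *: "poly (poly g 1) 1 \<noteq> 0" "r = Fract f g" "c = poly (poly f 1) 1 / poly (poly g 1) 1"
       "poly (poly g' 1) 1 \<noteq> 0" "s = Fract f' g'" "d = poly (poly f' 1) 1 / poly (poly g' 1) 1"
    by (auto simp: specializes_def)
  then show ?thesis
    by (intro specializesI[where f = "f * f'" and g = "g * g'"]) simp_all
qed

lemma specializes_const: "specializes (Fract [:[:c:]:] 1) c"
  by (intro specializesI[where f = "[:[:c:]:]" and g = 1]) simp_all

lemma specializes_0: "specializes 0 0"
  using specializes_const[of 0] by (simp add: Zero_fract_def)

lemma specializes_1: "specializes 1 1"
  using specializes_const[of 1] by (simp add: One_fract_def one_pCons)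

lemma specializes_minus: "specializes r c \<Longrightarrow> specializes (- r) (- c)"
proof -
  have "Fract [:[:-1:]:] 1 = (-1 :: Cpq)"
    by (simp add: One_fract_def one_pCons)
  then show "specializes r c \<Longrightarrow> specializes (- r) (- c)"
    using specializes_mult[OF specializes_const[of "-1"], of r c] by simp
qed

lemma specializes_diff: "specializes r c \<Longrightarrow> specializes s d \<Longrightarrow> specializes (r - s) (c - d)"
  using specializes_add[OF _ specializes_minus] by force

lemma specializes_inverse:
  assumes "specializes r c" "c \<noteq> 0"
  shows "specializes (inverse r) (inverse c)"
proof -
  from assms obtain f g where "poly (poly g 1) 1 \<noteq> 0" "r = Fract f g" "c = poly (poly f 1) 1 / poly (poly g 1) 1"
    by (auto simp: specializes_def)
  with \<open>c \<noteq> 0\<close> show ?thesis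
    by (intro specializesI[where f = g and g = f]) auto
qed

lemma specializes_divide:
  "specializes r c \<Longrightarrow> specializes s d \<Longrightarrow> d \<noteq> 0 \<Longrightarrow> specializes (r / s) (c / d)"
  by (simp add: divide_inverse specializes_mult specializes_inverse)

lemma specializes_p_ind: "specializes p_ind 1"
  unfolding p_ind_def by (intro specializesI[where f = "[:[:0, 1:]:]" and g = 1]) simp_all

lemma specializes_q_ind: "specializes q_ind 1"
  unfolding q_ind_def by (intro specializesI[where f = "[:0, 1:]" and g = 1]) simp_all

lemma specializes_inverse_p_ind: "specializes (inverse p_ind) 1"
  using specializes_inverse[OF specializes_p_ind] by simp

lemma specializes_inverse_q_ind: "specializes (inverse q_ind) 1"
  using specializes_inverse[OF specializes_q_ind] by simp

section \<open>Representations from pairs of matrices\<close>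

text \<open>The coefficient ring is left open so that one evaluation of words serves the Hecke
  algebra over C(p,q) and the group over the complex numbers.\<close>

fun gword_mat :: "nat \<Rightarrow> 'a :: comm_ring_1 mat \<Rightarrow> 'a mat \<Rightarrow> gword \<Rightarrow> 'a mat" where
  "gword_mat n A B (Word ws) = foldr (\<lambda>g M. (case g of G1 \<Rightarrow> A | G2 \<Rightarrow> B) * M) ws (1\<^sub>m n)"

context
  fixes n :: nat and A B :: "'a :: comm_ring_1 mat"
  assumes carr [simp]: "A \<in> carrier_mat n n" "B \<in> carrier_mat n n"
begin

lemma gword_mat_carrier [simp]: "gword_mat n A B w \<in> carrier_mat n n"
proof (cases w)
  case (Word ws)
  show ?thesis unfolding Word
    by (induction ws) (auto split: gen.split intro: mult_carrier_mat[OF carr(1)] mult_carrier_mat[OF carr(2)])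
qed

lemma gword_mat_zero [simp]: "gword_mat n A B 0 = 1\<^sub>m n"
  by (simp add: zero_gword_def)

lemma gword_mat_gen: "gword_mat n A B (Word [G1]) = A" "gword_mat n A B (Word [G2]) = B"
  by (simp_all add: right_mult_one_mat[of _ n n])

lemma gword_mat_add: "gword_mat n A B (u + v) = gword_mat n A B u * gword_mat n A B v"
proof (cases u; cases v)
  fix us vs assume [simp]: "u = Word us" "v = Word vs"
  have "gword_mat n A B (Word (us @ vs)) = gword_mat n A B (Word us) * gword_mat n A B (Word vs)"
  proof (induction us)
    case Nil
    show ?case using gword_mat_carrier[of "Word vs"] by simp
  next
    case (Cons g us)
    have "C * gword_mat n A B (Word (us @ vs)) = C * gword_mat n A B (Word us) * gword_mat n A B (Word vs)"
      if "C \<in> carrier_mat n n" for C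
      unfolding Cons.IH by (rule assoc_mult_mat[OF that gword_mat_carrier gword_mat_carrier, symmetric])
    then show ?case by (cases g) simp_all
  qed
  then show ?thesis by simp
qed

end

text \<open>Linear extension of \<open>gword_mat\<close>. The sum is formed entrywise because
  matrices of all sizes together have no common zero.\<close>

definition free_eval :: "nat \<Rightarrow> Cpq mat \<Rightarrow> Cpq mat \<Rightarrow> free_alg \<Rightarrow> Cpq mat" where
  "free_eval n A B f = mat n n (\<lambda>ij. \<Sum>w\<in>Poly_Mapping.keys f. Poly_Mapping.lookup f w * gword_mat n A B w $$ ij)"

lemma free_eval_carrier [simp]: "free_eval n A B f \<in> carrier_mat n n"
  by (simp add: free_eval_def)

lemma free_eval_add: "free_eval n A B (f + g) = free_eval n A B f + free_eval n A B g"
  by (intro eq_matI) (auto simp: free_eval_def setsum_keys_plus_distrib[of "\<lambda>w c. c * gword_mat n A B w $$ _"] distrib_right)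

context
  fixes n :: nat and A B :: "Cpq mat"
  assumes carr: "A \<in> carrier_mat n n" "B \<in> carrier_mat n n"
begin

lemma one_smult_mat: "1 \<cdot>\<^sub>m M = M" for M :: "'b :: monoid_mult mat"
  by (intro eq_matI) auto

lemma smult_smult_mat: "c \<cdot>\<^sub>m (d \<cdot>\<^sub>m M) = (c * d) \<cdot>\<^sub>m M" for M :: "'b :: semigroup_mult mat"
  by (intro eq_matI) (auto simp: mult.assoc)

lemma free_eval_single: "free_eval n A B (Poly_Mapping.single k c) = c \<cdot>\<^sub>m gword_mat n A B k"
  using gword_mat_carrier[OF carr, of k] by (intro eq_matI) (auto simp: free_eval_def)

lemma free_eval_mult: "free_eval n A B (f * g) = free_eval n A B f * free_eval n A B g"
proof (induction f rule: poly_mapping_add_single_induct)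
  case (single k c)
  show ?case
  proof (induction g rule: poly_mapping_add_single_induct)
    case (single l d)
    show ?case
      using gword_mat_carrier[OF carr, of k] gword_mat_carrier[OF carr, of l]
      by (simp add: mult_single free_eval_single gword_mat_add[OF carr] mult_smult_assoc_mat[of _ n n _ n]
          mult_smult_distrib[of _ n n _ n] smult_smult_mat mult.commute)
  next
    case (add f g)
    then show ?case
      by (simp add: distrib_left free_eval_add mult_add_distrib_mat[of _ n n _ n])
  qed
next
  case (add f g)
  then show ?case
    by (simp add: distrib_right free_eval_add add_mult_distrib_mat[of _ n n _ _ n])
qed

lemma free_eval_diff: "free_eval n A B (f - g) = free_eval n A B f - free_eval n A B g"
proof -
  have "free_eval n A B f = free_eval n A B (f - g) + free_eval n A B g"
    by (simp flip: free_eval_add)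
  then show ?thesis
    using free_eval_carrier[of n A B] by (intro eq_matI) (auto simp: carrier_matD[OF free_eval_carrier])
qed

lemma free_eval_scalar: "free_eval n A B (free_scalar c) = c \<cdot>\<^sub>m 1\<^sub>m n"
  by (simp add: free_scalar_def free_eval_single gword_mat_zero[OF carr])

lemma free_eval_one: "free_eval n A B 1 = 1\<^sub>m n"
  using free_eval_single[of 0 1] gword_mat_zero[OF carr] by (simp add: one_smult_mat)

lemma free_eval_gen: "free_eval n A B X1 = A" "free_eval n A B X2 = B"
  by (simp_all add: X1_def X2_def free_eval_single gword_mat_gen[OF carr] one_smult_mat del: gword_mat.simps)

end

definition hg2_relations :: "nat \<Rightarrow> Cpq mat \<Rightarrow> Cpq mat \<Rightarrow> bool" where
  "hg2_relations n A B \<longleftrightarrow> A \<in> carrier_mat n n \<and> B \<in> carrier_mat n n \<and>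
     A * B * A * B * A * B = B * A * B * A * B * A \<and>
     A * A = (p_ind - inverse p_ind) \<cdot>\<^sub>m A + 1\<^sub>m n \<and>
     B * B = (q_ind - inverse q_ind) \<cdot>\<^sub>m B + 1\<^sub>m n"

text \<open>Only pairs satisfying the relations induce a map on the quotient, so evaluation uses a
  chosen representative; \<open>hg2_mat_rep_abs\<close> shows independence of the choice for such
  pairs.\<close>

definition hg2_mat_rep :: "nat \<Rightarrow> Cpq mat \<Rightarrow> Cpq mat \<Rightarrow> hg2 \<Rightarrow> Cpq mat" where
  "hg2_mat_rep n A B h = free_eval n A B (rep_hg2 h)"

context
  fixes n :: nat and A B :: "Cpq mat"
  assumes rel: "hg2_relations n A B"
begin

lemma hg2_relations_carrier: "A \<in> carrier_mat n n" "B \<in> carrier_mat n n"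
  using rel by (simp_all add: hg2_relations_def)

text \<open>The relators evaluate to zero by the relations, and the kernel of a multiplicative
  linear map is a two-sided ideal.\<close>

lemma free_eval_ideal: "x \<in> hg2_ideal \<Longrightarrow> free_eval n A B x = 0\<^sub>m n n"
proof (induction rule: hg2_ideal.induct)
  case (base r)
  have "c \<cdot>\<^sub>m 1\<^sub>m n * A = c \<cdot>\<^sub>m A" "c \<cdot>\<^sub>m 1\<^sub>m n * B = c \<cdot>\<^sub>m B" for c
    using hg2_relations_carrier by (simp_all add: mult_smult_assoc_mat[of _ n n _ n])
  moreover have "M - M = 0\<^sub>m n n" if "M \<in> carrier_mat n n" for M :: "Cpq mat"
    using that by auto
  ultimately show ?case
    using base rel hg2_relations_carrier
    by (auto simp: hg2_relators_def hg2_relations_def power2_eq_square free_eval_diff[OF hg2_relations_carrier] free_eval_mult[OF hg2_relations_carrier]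
        free_eval_add free_eval_scalar[OF hg2_relations_carrier] free_eval_one[OF hg2_relations_carrier] free_eval_gen[OF hg2_relations_carrier])
next
  case zero
  show ?case by (auto simp: free_eval_def)
qed (auto simp: free_eval_diff[OF hg2_relations_carrier] free_eval_mult[OF hg2_relations_carrier] left_mult_zero_mat[of _ n n] right_mult_zero_mat[of _ n n])

lemma hg2_mat_rep_abs: "hg2_mat_rep n A B (abs_hg2 f) = free_eval n A B f"
proof -
  have "hg2_cong (rep_hg2 (abs_hg2 f)) f"
    by (metis Quotient_hg2 Quotient_rep_abs hg2_cong_refl)
  then have z: "free_eval n A B (rep_hg2 (abs_hg2 f)) - free_eval n A B f = 0\<^sub>m n n"
    using free_eval_ideal by (simp add: hg2_cong_def flip: free_eval_diff[OF hg2_relations_carrier])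
  show ?thesis
  proof (rule eq_matI)
    fix i j assume "i < dim_row (free_eval n A B f)" "j < dim_col (free_eval n A B f)"
    then show "hg2_mat_rep n A B (abs_hg2 f) $$ (i, j) = free_eval n A B f $$ (i, j)"
      using arg_cong[OF z, of "\<lambda>M. M $$ (i, j)"]
      by (simp add: hg2_mat_rep_def carrier_matD[OF free_eval_carrier])
  qed (simp_all add: hg2_mat_rep_def carrier_matD[OF free_eval_carrier])
qed

lemma hg2_mat_rep_gen: "hg2_mat_rep n A B T1 = A" "hg2_mat_rep n A B T2 = B"
  by (simp_all add: T1.abs_eq T2.abs_eq hg2_mat_rep_abs free_eval_gen[OF hg2_relations_carrier])

lemma hg2_rep_hg2_mat_rep: "hg2_rep n (hg2_mat_rep n A B)"
proof -
  have abs: "\<exists>f. h = abs_hg2 f" for h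
    by (metis Quotient_hg2 Quotient_abs_rep)
  have "hg2_mat_rep n A B (x + y) = hg2_mat_rep n A B x + hg2_mat_rep n A B y" for x y
    using abs[of x] abs[of y] by (auto simp: plus_hg2.abs_eq hg2_mat_rep_abs free_eval_add)
  moreover have "hg2_mat_rep n A B (x * y) = hg2_mat_rep n A B x * hg2_mat_rep n A B y" for x y
    using abs[of x] abs[of y] by (auto simp: times_hg2.abs_eq hg2_mat_rep_abs free_eval_mult[OF hg2_relations_carrier])
  moreover have "hg2_mat_rep n A B (hg2_scalar c) = c \<cdot>\<^sub>m 1\<^sub>m n" for c
    by (simp add: hg2_scalar.abs_eq hg2_mat_rep_abs free_eval_scalar[OF hg2_relations_carrier])
  moreover have "hg2_mat_rep n A B 1 = 1\<^sub>m n"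
    by (simp add: one_hg2.abs_eq hg2_mat_rep_abs free_eval_one[OF hg2_relations_carrier])
  moreover have carrier: "hg2_mat_rep n A B x \<in> carrier_mat n n" for x
    by (simp add: hg2_mat_rep_def)
  moreover have "c \<cdot>\<^sub>m 1\<^sub>m n * hg2_mat_rep n A B x = c \<cdot>\<^sub>m hg2_mat_rep n A B x" for c x
    using carrier[of x] by (simp add: mult_smult_assoc_mat[of _ n n _ n])
  ultimately show ?thesis by (simp add: hg2_rep_def)
qed

end

section \<open>Representations of the dihedral group from two involutory matrices\<close>

definition wg2_mat_rep :: "nat \<Rightarrow> complex mat \<Rightarrow> complex mat \<Rightarrow> wg2 \<Rightarrow> complex mat" where
  "wg2_mat_rep n A B g = gword_mat n A B (rep_wg2 g)"

context
  fixes n :: nat and A B :: "complex mat"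
  assumes AB: "A \<in> carrier_mat n n" "B \<in> carrier_mat n n"
    and sq: "A * A = 1\<^sub>m n" "B * B = 1\<^sub>m n"
    and braid: "A * (B * (A * (B * (A * B)))) = B * (A * (B * (A * (B * A))))"
begin

lemma gword_mat_cong: "wg2_cong u v \<Longrightarrow> gword_mat n A B u = gword_mat n A B v"
proof (induction rule: wg2_cong.induct)
  case (invol g)
  show ?case using AB sq by (cases g) simp_all
qed (use AB braid in \<open>simp_all add: gword_mat_add[OF AB]\<close>)

lemma wg2_mat_rep_abs: "wg2_mat_rep n A B (abs_wg2 w) = gword_mat n A B w"
  unfolding wg2_mat_rep_def
  by (rule gword_mat_cong) (metis Quotient_wg2 Quotient_rep_abs wg2_cong.refl)

lemma wg2_mat_rep_gen: "wg2_mat_rep n A B s1 = A" "wg2_mat_rep n A B s2 = B"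
  using AB by (simp_all add: s1.abs_eq s2.abs_eq wg2_mat_rep_abs)

lemma wg2_rep_wg2_mat_rep: "wg2_rep n (wg2_mat_rep n A B)"
proof -
  have abs: "\<exists>f. h = abs_wg2 f" for h
    by (metis Quotient_wg2 Quotient_abs_rep)
  have "wg2_mat_rep n A B (x * y) = wg2_mat_rep n A B x * wg2_mat_rep n A B y" for x y
    using abs[of x] abs[of y] by (auto simp: times_wg2.abs_eq wg2_mat_rep_abs gword_mat_add[OF AB])
  moreover have "wg2_mat_rep n A B 1 = 1\<^sub>m n"
    by (simp add: one_wg2.abs_eq wg2_mat_rep_abs gword_mat_zero[OF AB])
  moreover have "wg2_mat_rep n A B x \<in> carrier_mat n n" for x
    using AB by (simp add: wg2_mat_rep_def)
  ultimately show ?thesis by (simp add: wg2_rep_def)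
qed

end

section \<open>Matrices of size one and two\<close>

abbreviation (input) "mat1 a \<equiv> mat_of_rows_list 1 [[a]]"
abbreviation (input) "mat2 a b c d \<equiv> mat_of_rows_list 2 [[a, b], [c, d]]"

lemma mat1_simps:
  fixes a b :: "'a :: comm_ring_1"
  shows "mat1 a \<in> carrier_mat 1 1"
    and "mat1 a * mat1 b = mat1 (a * b)"
    and "mat1 a + mat1 b = mat1 (a + b)"
    and "a \<cdot>\<^sub>m mat1 b = mat1 (a * b)"
    and "1\<^sub>m 1 = mat1 (1 :: 'a)"
    and "trace_mat (mat1 a) = a"
  by (auto simp: mat_of_rows_list_def scalar_prod_def trace_mat_def)

lemma mat2_simps:
  fixes a b c d :: "'a :: comm_ring_1"
  shows "mat2 a b c d \<in> carrier_mat 2 2"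
    and "mat2 a b c d * mat2 a' b' c' d' =
      mat2 (a * a' + b * c') (a * b' + b * d') (c * a' + d * c') (c * b' + d * d')"
    and "mat2 a b c d + mat2 a' b' c' d' = mat2 (a + a') (b + b') (c + c') (d + d')"
    and "r \<cdot>\<^sub>m mat2 a b c d = mat2 (r * a) (r * b) (r * c) (r * d)"
    and "1\<^sub>m 2 = mat2 1 0 0 (1 :: 'a)"
    and "trace_mat (mat2 a b c d) = a + d"
proof -
  note mat2_defs = mat_of_rows_list_def scalar_prod_def trace_mat_def numeral_2_eq_2 less_Suc_eq
  show "mat2 a b c d \<in> carrier_mat 2 2" and "trace_mat (mat2 a b c d) = a + d"
    by (auto simp: mat2_defs)
  show "mat2 a b c d * mat2 a' b' c' d' =
      mat2 (a * a' + b * c') (a * b' + b * d') (c * a' + d * c') (c * b' + d * d')"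
    by (rule eq_matI; auto simp: mat2_defs)
  show "mat2 a b c d + mat2 a' b' c' d' = mat2 (a + a') (b + b') (c + c') (d + d')"
    by (rule eq_matI; auto simp: mat2_defs)
  show "r \<cdot>\<^sub>m mat2 a b c d = mat2 (r * a) (r * b) (r * c) (r * d)"
    by (rule eq_matI; auto simp: mat2_defs)
  show "1\<^sub>m 2 = mat2 1 0 0 (1 :: 'a)"
    by (rule eq_matI; auto simp: mat2_defs)
qed

definition vec2 :: "'a \<Rightarrow> 'a \<Rightarrow> 'a vec" where
  "vec2 x y = vec_of_list [x, y]"

lemma vec2_simps:
  fixes x y :: "'a :: comm_ring_1"
  shows "vec2 x y \<in> carrier_vec 2"
    and "vec2 x y + vec2 x' y' = vec2 (x + x') (y + y')"
    and "r \<cdot>\<^sub>v vec2 x y = vec2 (r * x) (r * y)"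
    and "mat2 a b c d *\<^sub>v vec2 x y = vec2 (a * x + b * y) (c * x + d * y)"
    and "0\<^sub>v 2 = vec2 0 (0 :: 'a)"
    and "unit_vec 2 0 = vec2 1 (0 :: 'a)"
    and "unit_vec 2 1 = vec2 0 (1 :: 'a)"
proof -
  have dim [simp]: "dim_vec (vec2 x y) = Suc (Suc 0)" for x y :: 'a
    by (simp add: vec2_def)
  have index [simp]: "vec2 x y $ 0 = x" "vec2 x y $ Suc 0 = y" for x y :: 'a
    by (simp_all add: vec2_def)
  note vec2_defs = mat_of_rows_list_def scalar_prod_def numeral_2_eq_2 less_Suc_eq
  show "vec2 x y \<in> carrier_vec 2"
    by (rule carrier_vecI) simp
  show "vec2 x y + vec2 x' y' = vec2 (x + x') (y + y')" "r \<cdot>\<^sub>v vec2 x y = vec2 (r * x) (r * y)"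
    "mat2 a b c d *\<^sub>v vec2 x y = vec2 (a * x + b * y) (c * x + d * y)" "0\<^sub>v 2 = vec2 0 (0 :: 'a)"
    "unit_vec 2 0 = vec2 1 (0 :: 'a)" "unit_vec 2 1 = vec2 0 (1 :: 'a)"
    by (rule eq_vecI; auto simp: vec2_defs)+
qed

lemma vec2_cases:
  assumes "v \<in> carrier_vec 2"
  obtains x y where "v = vec2 x y"
proof
  show "v = vec2 (v $ 0) (v $ 1)"
    using assms by (intro eq_vecI) (auto simp: vec2_def numeral_2_eq_2 less_Suc_eq)
qed

text \<open>Cayley-Hamilton gives M^2 = tM - 1, hence M^3 = (t^2 - 1) M - t, and t^2 = 1. The
  auxiliary equations are these identities entry by entry.\<close>

lemma mat2_cube:
  fixes t u v w z :: "'a :: comm_ring_1"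
  assumes t: "u + z = t" and det: "u * z - v * w = 1" and "t * t = 1"
  shows "mat2 u v w z * (mat2 u v w z * mat2 u v w z) = mat2 (- t) 0 0 (- t)"
proof -
  have "v * w = u * z - 1" using det by (simp add: algebra_simps)
  then have diag: "u * u + v * w = t * u - 1" "w * v + z * z = t * z - 1"
    using t[symmetric] by (simp_all add: algebra_simps)
  have offdiag: "u * v + v * z = t * v" "w * u + z * w = t * w"
    using t[symmetric] by (simp_all add: algebra_simps)
  have "u * (t * u - 1) + v * (t * w) = t * (u * u + v * w) - u"
    "u * (t * v) + v * (t * z - 1) = t * (u * v + v * z) - v"
    "w * (t * u - 1) + z * (t * w) = t * (w * u + z * w) - w"
    "w * (t * v) + z * (t * z - 1) = t * (w * v + z * z) - z"
    by (simp_all add: algebra_simps)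
  moreover have "t * (t * x) = x" for x
    using \<open>t * t = 1\<close> by (simp flip: mult.assoc)
  ultimately show ?thesis
    by (simp add: mat2_simps(2) diag offdiag right_diff_distrib)
qed

text \<open>Both rows of \<open>B\<close> sum to q, so (1,1) is an eigenvector with eigenvalue q,
  and the trace q - Q makes -Q the other one. The equation for \<open>a\<close> says exactly that
  \<open>A * B\<close> has trace t; as the determinant is 1, the cubes of \<open>A * B\<close> and
  \<open>B * A\<close> are the same scalar.\<close>

lemma mat2_braid:
  fixes p q P Q a t :: "'a :: comm_ring_1"
  assumes P: "p * P = 1" and Q: "q * Q = 1" and a: "a * (p + P) = t + P * (q - Q)" and t: "t * t = 1"
  defines "A \<equiv> mat2 p 0 0 (- P)" and "B \<equiv> mat2 a (q - a) (Q + a) (q - Q - a)"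
  shows "A * B * A * B * A * B = B * A * B * A * B * A"
    and "B * B = (q - Q) \<cdot>\<^sub>m B + 1\<^sub>m 2"
    and "A * A = (p - P) \<cdot>\<^sub>m A + 1\<^sub>m 2"
proof -
  have carr: "A \<in> carrier_mat 2 2" "B \<in> carrier_mat 2 2"
    unfolding A_def B_def by (rule mat2_simps)+
  have assoc: "C * D * C * D * C * D = C * D * (C * D * (C * D))"
    if "C \<in> carrier_mat 2 2" "D \<in> carrier_mat 2 2" for C D :: "'a mat"
    using that by (simp add: assoc_mult_mat[of _ 2 2 _ 2 _ 2])
  have tr: "p * a + - P * (q - Q - a) = t"
    using a by (simp add: algebra_simps)
  have det: "p * a * (- P * (q - Q - a)) - p * (q - a) * (- P * (Q + a)) = 1"
    "p * a * (- P * (q - Q - a)) - - P * (q - a) * (p * (Q + a)) = 1"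
  proof -
    have "p * a * (- P * (q - Q - a)) - p * (q - a) * (- P * (Q + a)) = (p * P) * (q * Q)"
      "p * a * (- P * (q - Q - a)) - - P * (q - a) * (p * (Q + a)) = (p * P) * (q * Q)"
      by (simp_all add: algebra_simps)
    then show "p * a * (- P * (q - Q - a)) - p * (q - a) * (- P * (Q + a)) = 1"
      "p * a * (- P * (q - Q - a)) - - P * (q - a) * (p * (Q + a)) = 1"
      using P Q by simp_all
  qed
  have AB: "A * B = mat2 (p * a) (p * (q - a)) (- P * (Q + a)) (- P * (q - Q - a))"
    and BA: "B * A = mat2 (p * a) (- P * (q - a)) (p * (Q + a)) (- P * (q - Q - a))"
    unfolding A_def B_def mat2_simps(2) by (simp_all add: mult.commute)
  show "A * B * A * B * A * B = B * A * B * A * B * A"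
    unfolding assoc[OF carr] assoc[OF carr(2,1)] unfolding AB BA
    by (simp only: mat2_cube[OF tr det(1) t] mat2_cube[OF tr det(2) t])
  \<comment> \<open>Replacing 1 by \<open>q * Q\<close> turns every entry into a polynomial
    identity.\<close>
  have "a * a + (q - a) * (Q + a) = (q - Q) * a + 1"
    "a * (q - a) + (q - a) * (q - Q - a) = (q - Q) * (q - a) + 0"
    "(Q + a) * a + (q - Q - a) * (Q + a) = (q - Q) * (Q + a) + 0"
    "(Q + a) * (q - a) + (q - Q - a) * (q - Q - a) = (q - Q) * (q - Q - a) + 1"
    unfolding Q[symmetric] by (simp_all add: algebra_simps)
  then show "B * B = (q - Q) \<cdot>\<^sub>m B + 1\<^sub>m 2"
    unfolding B_def mat2_simps(2-5) by simp
  have "p * p + 0 * 0 = (p - P) * p + 1" "- P * - P = (p - P) * - P + 1"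
    unfolding P[symmetric] by (simp_all add: algebra_simps)
  then show "A * A = (p - P) \<cdot>\<^sub>m A + 1\<^sub>m 2"
    unfolding A_def mat2_simps(2-5) by simp
qed

section \<open>Irreducibility and seminormality\<close>

context hg2_module
begin

text \<open>A line has no intermediate subspaces, so stability is all that counts. Leaving
  \<open>H\<close> open covers both steps of the chain as well as the whole algebra.\<close>

lemma irreducible_eigenline:
  assumes v: "v \<in> carrier_vec n" "v \<noteq> 0\<^sub>v n" and eig: "\<And>h. h \<in> H \<Longrightarrow> \<exists>c. \<rho> h *\<^sub>v v = c \<cdot>\<^sub>v v"
  shows "irreducible_subspace n \<rho> H (range (\<lambda>c. c \<cdot>\<^sub>v v))"
proof -
  let ?W = "range (\<lambda>c. c \<cdot>\<^sub>v v)"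
  have "v \<in> ?W" by (rule range_eqI[of _ _ 1]) simp
  have "VectorSpace.subspace class_ring ?W (Kvec n)"
    using v(1) by (rule subspace_line)
  moreover have "\<rho> h *\<^sub>v w \<in> ?W" if "h \<in> H" "w \<in> ?W" for h w
    using that eig[of h] v by (auto simp: act_simps smult_smult_assoc)
  moreover have "U = {0\<^sub>v n} \<or> U = ?W" if U: "invariant_subspace n \<rho> H U" "U \<subseteq> ?W" for U
  proof (rule disjCI)
    assume "U \<noteq> ?W"
    show "U = {0\<^sub>v n}"
    proof (rule ccontr)
      have sub: "0\<^sub>v n \<in> U" "\<And>c u. u \<in> U \<Longrightarrow> c \<cdot>\<^sub>v u \<in> U"
        using U(1) by (auto simp: invariant_subspace_def subspace_Kvec_iff)
      assume "U \<noteq> {0\<^sub>v n}"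
      then obtain u where u: "u \<in> U" "u \<noteq> 0\<^sub>v n" using sub(1) by blast
      then obtain c where c: "u = c \<cdot>\<^sub>v v" using U(2) by blast
      with u v have "c \<noteq> 0" by auto
      then have "d \<cdot>\<^sub>v v = (d / c) \<cdot>\<^sub>v u" for d
        by (simp add: c smult_smult_assoc)
      then have "?W \<subseteq> U" using sub(2) u(1) by auto
      with U(2) \<open>U \<noteq> ?W\<close> show False by blast
    qed
  qed
  ultimately show ?thesis
    using v \<open>v \<in> ?W\<close> unfolding irreducible_subspace_def invariant_subspace_def by blast
qed

text \<open>The elements having \<open>v\<close> as an eigenvector form a subalgebra, which contains
  the hull of \<open>T1\<close> as soon as it contains \<open>T1\<close>.\<close>

lemma HA1_eigenvector:
  assumes v: "v \<in> carrier_vec n" and T1: "\<rho> T1 *\<^sub>v v = \<alpha> \<cdot>\<^sub>v v" and "h \<in> HA1"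
  shows "\<exists>c. \<rho> h *\<^sub>v v = c \<cdot>\<^sub>v v"
proof -
  let ?S = "{h. \<exists>c. \<rho> h *\<^sub>v v = c \<cdot>\<^sub>v v}"
  have "hg2_subalgebra ?S"
    unfolding hg2_subalgebra_def
  proof (intro conjI ballI)
    show "range hg2_scalar \<subseteq> ?S" using v by (auto simp: act_simps)
  next
    fix x y assume "x \<in> ?S" "y \<in> ?S"
    then obtain c d where "\<rho> x *\<^sub>v v = c \<cdot>\<^sub>v v" "\<rho> y *\<^sub>v v = d \<cdot>\<^sub>v v" by blast
    then have "\<rho> (x + y) *\<^sub>v v = (c + d) \<cdot>\<^sub>v v" "\<rho> (x * y) *\<^sub>v v = (d * c) \<cdot>\<^sub>v v"
      using v by (simp_all add: act_simps add_smult_distrib_vec smult_smult_assoc)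
    then show "x + y \<in> ?S" "x * y \<in> ?S" by blast+
  qed
  then have "HA1 \<subseteq> ?S"
    unfolding HA1_def using T1 by (intro hull_minimal) auto
  with \<open>h \<in> HA1\<close> show ?thesis by blast
qed

text \<open>When \<open>T1\<close> is diagonal, every coordinate line is already irreducible under
  \<open>HA1\<close>; singletons form the partition there, and the step to \<open>HA0\<close> splits
  nothing further.\<close>

lemma seminormal_unit_vecs:
  assumes "\<And>i. i < n \<Longrightarrow> \<exists>\<alpha>. \<rho> T1 *\<^sub>v unit_vec n i = \<alpha> \<cdot>\<^sub>v unit_vec n i"
  shows "seminormal_basis n \<rho> [HA1, HA0] (set (unit_vecs n))"
proof -
  interpret vec_space "TYPE(Cpq)" n .
  have part: "partition_on B ((\<lambda>v. {v}) ` B)" for B :: "Cpq vec set"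
    by (rule partition_onI) (auto simp: disjnt_def)
  have irr: "irreducible_subspace n \<rho> HA1 (LinearCombinations.module.span class_ring (Kvec n) {v})"
    "irreducible_subspace n \<rho> HA0 (LinearCombinations.module.span class_ring (Kvec n) {v})"
    if v: "v \<in> set (unit_vecs n)" for v
  proof -
    from v obtain i where i: "i < n" "v = unit_vec n i" by (auto simp: unit_vecs_def)
    then have "v $ i \<noteq> 0\<^sub>v n $ i" by simp
    then have *: "v \<in> carrier_vec n" "v \<noteq> 0\<^sub>v n" using i by auto
    obtain \<alpha> where "\<rho> T1 *\<^sub>v v = \<alpha> \<cdot>\<^sub>v v" using assms i by blast
    then show "irreducible_subspace n \<rho> HA1 (LinearCombinations.module.span class_ring (Kvec n) {v})"
      unfolding span_singleton_Kvec[OF *(1)]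
      using * by (intro irreducible_eigenline) (blast intro: HA1_eigenvector)+
    show "irreducible_subspace n \<rho> HA0 (LinearCombinations.module.span class_ring (Kvec n) {v})"
      unfolding span_singleton_Kvec[OF *(1)]
      using * by (intro irreducible_eigenline) (auto simp: HA0_def act_simps)
  qed
  have "seminormal_split n \<rho> [HA0] {v}" if "v \<in> set (unit_vecs n)" for v
    unfolding seminormal_split.simps
    using irr(2)[OF that] part[of "{v}"] by (intro exI[of _ "{{v}}"]) simp
  with irr(1) have "\<forall>C \<in> (\<lambda>v. {v}) ` set (unit_vecs n).
      irreducible_subspace n \<rho> HA1 (LinearCombinations.module.span class_ring (Kvec n) C) \<and>
      seminormal_split n \<rho> [HA0] C"
    by blast
  with part have "seminormal_split n \<rho> [HA1, HA0] (set (unit_vecs n))"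
    unfolding seminormal_split.simps(2)[of _ _ HA1] by blast
  then show ?thesis
    using unit_vecs_basis by (simp add: seminormal_basis_def)
qed

lemma irreducible_seminormal_rep_1:
  assumes [simp]: "n = 1"
  shows "irreducible_seminormal_rep n \<rho>"
proof -
  have eig: "\<exists>c. \<rho> h *\<^sub>v unit_vec n 0 = c \<cdot>\<^sub>v unit_vec n 0" for h
    by (intro exI[of _ "\<rho> h $$ (0, 0)"] eq_vecI) auto
  have carrier: "carrier_vec n = range (\<lambda>c. c \<cdot>\<^sub>v (unit_vec n 0 :: Cpq vec))"
  proof
    show "carrier_vec n \<subseteq> range (\<lambda>c. c \<cdot>\<^sub>v (unit_vec n 0 :: Cpq vec))"
    proof
      fix v :: "Cpq vec" assume "v \<in> carrier_vec n"
      then have "v = (v $ 0) \<cdot>\<^sub>v unit_vec n 0" by (intro eq_vecI) auto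
      then show "v \<in> range (\<lambda>c. c \<cdot>\<^sub>v (unit_vec n 0 :: Cpq vec))" by blast
    qed
  qed auto
  have "(unit_vec n 0 :: Cpq vec) \<noteq> 0\<^sub>v n" by (auto dest: arg_cong[of _ _ "\<lambda>v. v $ 0"])
  then have "irreducible_subspace n \<rho> UNIV (carrier_vec n)"
    unfolding carrier using eig by (intro irreducible_eigenline) auto
  moreover have "seminormal_basis n \<rho> [HA1, HA0] (set (unit_vecs n))"
    using eig[of T1] by (intro seminormal_unit_vecs) auto
  ultimately show ?thesis
    using rep by (simp add: irreducible_seminormal_rep_def irreducible_rep_def)
qed

text \<open>Distinct eigenvalues of \<open>T1\<close> let an invariant subspace be projected onto
  the coordinate axes, and the nonzero off-diagonal entries of \<open>T2\<close> lead from either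
  axis to the other.\<close>

lemma irreducible_seminormal_rep_2:
  assumes n: "n = 2"
    and T1: "\<rho> T1 = mat2 \<alpha> 0 0 \<beta>" and T2: "\<rho> T2 = mat2 a b c d"
    and nz: "\<alpha> \<noteq> \<beta>" "b \<noteq> 0" "c \<noteq> 0"
  shows "irreducible_seminormal_rep n \<rho>"
proof -
  have "U = {0\<^sub>v 2} \<or> U = carrier_vec 2" if U: "invariant_subspace 2 \<rho> UNIV U" for U
  proof (rule disjCI)
    assume "U \<noteq> carrier_vec 2"
    have Usub: "U \<subseteq> carrier_vec 2" "vec2 0 0 \<in> U" and Uadd: "\<And>u v. u \<in> U \<Longrightarrow> v \<in> U \<Longrightarrow> u + v \<in> U"
      and Usmult: "\<And>r u. u \<in> U \<Longrightarrow> r \<cdot>\<^sub>v u \<in> U" and Uact: "\<And>h u. u \<in> U \<Longrightarrow> \<rho> h *\<^sub>v u \<in> U"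
      using U unfolding invariant_subspace_def subspace_Kvec_iff vec2_simps(5) by blast+
    have shift1: "vec2 ((\<alpha> + r) * x) ((\<beta> + r) * y) \<in> U" if "vec2 x y \<in> U" for r x y
      using Uadd[OF Uact[OF that, of T1] Usmult[OF that, of r]]
      unfolding T1 vec2_simps by (simp add: distrib_right)
    have shift2: "vec2 (a * x + b * y + r * x) (c * x + d * y + r * y) \<in> U" if "vec2 x y \<in> U" for r x y
      using Uadd[OF Uact[OF that, of T2] Usmult[OF that, of r]]
      unfolding T2 vec2_simps .
    have scale1: "vec2 1 0 \<in> U" if "vec2 x 0 \<in> U" "x \<noteq> 0" for x
      using Usmult[OF that(1), of "inverse x"] that(2) by (simp add: vec2_simps)
    have scale2: "vec2 0 1 \<in> U" if "vec2 0 x \<in> U" "x \<noteq> 0" for x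
      using Usmult[OF that(1), of "inverse x"] that(2) by (simp add: vec2_simps)
    have one_two: "vec2 0 1 \<in> U" if "vec2 1 0 \<in> U"
      using shift2[OF that, of "- a"] scale2 nz by simp
    have two_one: "vec2 1 0 \<in> U" if "vec2 0 1 \<in> U"
      using shift2[OF that, of "- d"] scale1 nz by simp
    have "\<not> (vec2 1 0 \<in> U \<and> vec2 0 1 \<in> U)"
    proof
      assume e: "vec2 1 0 \<in> U \<and> vec2 0 1 \<in> U"
      have all: "vec2 x y \<in> U" for x y
      proof -
        have "x \<cdot>\<^sub>v vec2 1 0 + y \<cdot>\<^sub>v vec2 0 1 \<in> U"
          using e by (intro Uadd Usmult) simp_all
        then show ?thesis by (simp add: vec2_simps)
      qed
      have "v \<in> U" if "v \<in> carrier_vec 2" for v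
        using that by (rule vec2_cases) (simp add: all)
      then have "carrier_vec 2 \<subseteq> U" by blast
      with Usub(1) \<open>U \<noteq> carrier_vec 2\<close> show False by blast
    qed
    then have none: "vec2 1 0 \<notin> U" "vec2 0 1 \<notin> U" using one_two two_one by blast+
    have "u = vec2 0 0" if "u \<in> U" for u
    proof -
      from that Usub(1) have "u \<in> carrier_vec 2" by blast
      then obtain x y where u: "u = vec2 x y" by (rule vec2_cases)
      have xy: "vec2 x y \<in> U" using that u by simp
      \<comment> \<open>Subtracting one eigenvalue from \<open>T1\<close> kills the corresponding
        coordinate and rescales the other.\<close>
      have "vec2 ((\<alpha> - \<beta>) * x) 0 \<in> U" "vec2 0 ((\<beta> - \<alpha>) * y) \<in> U"
        using shift1[OF xy, of "- \<beta>"] shift1[OF xy, of "- \<alpha>"] by simp_all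
      then have "(\<alpha> - \<beta>) * x = 0" "(\<beta> - \<alpha>) * y = 0"
        using scale1 scale2 none by blast+
      then have "x = 0" "y = 0" using nz(1) by simp_all
      then show ?thesis using u by simp
    qed
    then show "U = {0\<^sub>v 2}" unfolding vec2_simps(5) using Usub(2) by blast
  qed
  moreover have "carrier_vec 2 \<noteq> {0\<^sub>v 2 :: Cpq vec}"
  proof
    assume "carrier_vec 2 = {0\<^sub>v 2 :: Cpq vec}"
    then have "(unit_vec 2 0 :: Cpq vec) = 0\<^sub>v 2" using unit_vec_carrier by blast
    from arg_cong[OF this, of "\<lambda>v. v $ 0"] show False by simp
  qed
  moreover have "invariant_subspace 2 \<rho> UNIV (carrier_vec 2)"
    using act_carrier unfolding n by (simp add: invariant_subspace_def subspace_Kvec_iff)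
  ultimately have "irreducible_subspace n \<rho> UNIV (carrier_vec n)"
    unfolding irreducible_subspace_def n by blast
  moreover have "\<exists>\<gamma>. \<rho> T1 *\<^sub>v unit_vec n i = \<gamma> \<cdot>\<^sub>v unit_vec n i" if "i < n" for i
  proof -
    have "\<rho> T1 *\<^sub>v unit_vec 2 0 = \<alpha> \<cdot>\<^sub>v unit_vec 2 0" "\<rho> T1 *\<^sub>v unit_vec 2 1 = \<beta> \<cdot>\<^sub>v unit_vec 2 1"
      unfolding T1 vec2_simps by simp_all
    moreover from that have "i = 0 \<or> i = 1" unfolding n by auto
    ultimately show ?thesis unfolding n by blast
  qed
  then have "seminormal_basis n \<rho> [HA1, HA0] (set (unit_vecs n))"
    by (rule seminormal_unit_vecs)
  ultimately show ?thesis
    using rep unfolding irreducible_seminormal_rep_def irreducible_rep_def by blast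
qed

end

section \<open>The six representations\<close>

text \<open>Solving for the upper left entry of \<open>T2\<close> that gives \<open>T1 * T2\<close>
  trace t; t = 1 yields \<open>a\<close> and t = -1 yields \<open>x\<close> of the theorem.\<close>

definition seminormal_entry :: "Cpq \<Rightarrow> Cpq" where
  "seminormal_entry t = (t + inverse p_ind * (q_ind - inverse q_ind)) / (p_ind + inverse p_ind)"

definition seminormal_mat :: "Cpq \<Rightarrow> Cpq mat" where
  "seminormal_mat t = mat2 (seminormal_entry t) (q_ind - seminormal_entry t)
     (inverse q_ind + seminormal_entry t) (q_ind - inverse q_ind - seminormal_entry t)"

fun label_T1 :: "wg2_label \<Rightarrow> Cpq mat" where
  "label_T1 phi_1_0 = mat1 p_ind"
| "label_T1 phi_1_6 = mat1 (- inverse p_ind)"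
| "label_T1 phi_1_3a = mat1 p_ind"
| "label_T1 phi_1_3b = mat1 (- inverse p_ind)"
| "label_T1 _ = mat2 p_ind 0 0 (- inverse p_ind)"

fun label_T2 :: "wg2_label \<Rightarrow> Cpq mat" where
  "label_T2 phi_1_0 = mat1 q_ind"
| "label_T2 phi_1_6 = mat1 (- inverse q_ind)"
| "label_T2 phi_1_3a = mat1 (- inverse q_ind)"
| "label_T2 phi_1_3b = mat1 q_ind"
| "label_T2 phi_2_1 = seminormal_mat 1"
| "label_T2 phi_2_2 = seminormal_mat (- 1)"

definition label_rep :: "wg2_label \<Rightarrow> hg2 \<Rightarrow> Cpq mat" where
  "label_rep \<phi> = hg2_mat_rep (label_dim \<phi>) (label_T1 \<phi>) (label_T2 \<phi>)"

lemma p_ind_plus_inverse_nonzero: "p_ind + inverse p_ind \<noteq> 0"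
  by (rule specializes_nonzero[of _ 2]) (use specializes_add[OF specializes_p_ind specializes_inverse_p_ind] in simp_all)

lemma q_ind_plus_inverse_nonzero: "q_ind + inverse q_ind \<noteq> 0"
  by (rule specializes_nonzero[of _ 2]) (use specializes_add[OF specializes_q_ind specializes_inverse_q_ind] in simp_all)

lemma seminormal_entry_mult: "seminormal_entry t * (p_ind + inverse p_ind) = t + inverse p_ind * (q_ind - inverse q_ind)"
  using p_ind_plus_inverse_nonzero by (simp add: seminormal_entry_def)

lemma specializes_seminormal_entry:
  assumes "specializes t c"
  shows "specializes (seminormal_entry t) (c / 2)"
  using specializes_divide[OF specializes_add[OF assms specializes_mult[OF specializes_inverse_p_ind
          specializes_diff[OF specializes_q_ind specializes_inverse_q_ind]]]
        specializes_add[OF specializes_p_ind specializes_inverse_p_ind]]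
  by (simp add: seminormal_entry_def)

lemma hg2_relations_mat1:
  assumes "\<alpha> \<in> {p_ind, - inverse p_ind}" "\<beta> \<in> {q_ind, - inverse q_ind}"
  shows "hg2_relations 1 (mat1 \<alpha>) (mat1 \<beta>)"
proof -
  have "\<alpha> * \<alpha> = (p_ind - inverse p_ind) * \<alpha> + 1" "\<beta> * \<beta> = (q_ind - inverse q_ind) * \<beta> + 1"
    using assms p_ind_nonzero q_ind_nonzero by (auto simp: algebra_simps)
  then show ?thesis
    unfolding hg2_relations_def mat1_simps(2-5) by (simp add: mat1_simps(1)[simplified] mult_ac)
qed

lemma hg2_relations_mat2:
  assumes "t * t = 1"
  shows "hg2_relations 2 (mat2 p_ind 0 0 (- inverse p_ind)) (seminormal_mat t)"
  unfolding hg2_relations_def seminormal_mat_def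
  using mat2_braid[of p_ind "inverse p_ind" q_ind "inverse q_ind", OF _ _ seminormal_entry_mult assms]
    p_ind_nonzero q_ind_nonzero mat2_simps(1) by auto

lemma hg2_relations_label: "hg2_relations (label_dim \<phi>) (label_T1 \<phi>) (label_T2 \<phi>)"
  by (cases \<phi>) (auto intro!: hg2_relations_mat1[simplified] hg2_relations_mat2)

lemma hg2_rep_label_rep: "hg2_rep (label_dim \<phi>) (label_rep \<phi>)"
  unfolding label_rep_def by (rule hg2_rep_hg2_mat_rep[OF hg2_relations_label])

lemma label_rep_gen: "label_rep \<phi> T1 = label_T1 \<phi>" "label_rep \<phi> T2 = label_T2 \<phi>"
  unfolding label_rep_def by (rule hg2_mat_rep_gen[OF hg2_relations_label])+

lemma minus_inverse_p_ind_neq: "- inverse p_ind \<noteq> p_ind"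
  using p_ind_plus_inverse_nonzero by (metis neg_eq_iff_add_eq_0 add.commute)

lemma minus_inverse_q_ind_neq: "- inverse q_ind \<noteq> q_ind"
  using q_ind_plus_inverse_nonzero by (metis neg_eq_iff_add_eq_0 add.commute)

text \<open>At p = q = 1 the two entries become 1 - c/2 and 1 + c/2, that is 1/2 and 3/2 in some
  order.\<close>

lemma seminormal_entries_nonzero:
  assumes "specializes t c" "c \<in> {1, -1}"
  shows "q_ind - seminormal_entry t \<noteq> 0" "inverse q_ind + seminormal_entry t \<noteq> 0"
  using specializes_nonzero[OF specializes_diff[OF specializes_q_ind specializes_seminormal_entry[OF assms(1)]]]
    specializes_nonzero[OF specializes_add[OF specializes_inverse_q_ind specializes_seminormal_entry[OF assms(1)]]]
    assms(2) by auto

lemma specializes_minus_1: "specializes (- 1) (- 1)"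
  by (rule specializes_minus[OF specializes_1])

lemma irreducible_seminormal_label_rep: "irreducible_seminormal_rep (label_dim \<phi>) (label_rep \<phi>)"
proof -
  interpret hg2_module "label_dim \<phi>" "label_rep \<phi>"
    by unfold_locales (rule hg2_rep_label_rep)
  show ?thesis
  proof (cases "label_dim \<phi> = 1")
    case True
    then show ?thesis by (rule irreducible_seminormal_rep_1)
  next
    case False
    then obtain t where t: "label_dim \<phi> = 2" "t \<in> {1, -1}" "label_T1 \<phi> = mat2 p_ind 0 0 (- inverse p_ind)"
      "label_T2 \<phi> = seminormal_mat t"
      by (cases \<phi>) auto
    then have nz: "q_ind - seminormal_entry t \<noteq> 0" "inverse q_ind + seminormal_entry t \<noteq> 0"
      using seminormal_entries_nonzero[OF specializes_1] seminormal_entries_nonzero[OF specializes_minus_1] by auto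
    show ?thesis
      using t(1) label_rep_gen(1)[of \<phi>, unfolded t(3)] label_rep_gen(2)[of \<phi>, unfolded t(4) seminormal_mat_def]
        minus_inverse_p_ind_neq[symmetric] nz
      by (rule irreducible_seminormal_rep_2)
  qed
qed

lemma irreducible_label_rep: "irreducible_rep (label_dim \<phi>) (label_rep \<phi>)"
  using irreducible_seminormal_label_rep by (simp add: irreducible_seminormal_rep_def)

fun label_s1 :: "wg2_label \<Rightarrow> complex mat" where
  "label_s1 phi_1_0 = mat1 1"
| "label_s1 phi_1_6 = mat1 (- 1)"
| "label_s1 phi_1_3a = mat1 1"
| "label_s1 phi_1_3b = mat1 (- 1)"
| "label_s1 _ = mat2 1 0 0 (- 1)"

text \<open>The two-dimensional matrices are the seminormal ones at p = q = 1, where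
  \<open>seminormal_entry t\<close> takes the value t/2.\<close>

fun label_s2 :: "wg2_label \<Rightarrow> complex mat" where
  "label_s2 phi_1_0 = mat1 1"
| "label_s2 phi_1_6 = mat1 (- 1)"
| "label_s2 phi_1_3a = mat1 (- 1)"
| "label_s2 phi_1_3b = mat1 1"
| "label_s2 phi_2_1 = mat2 (1/2) (1/2) (3/2) (- 1/2)"
| "label_s2 phi_2_2 = mat2 (- 1/2) (3/2) (1/2) (1/2)"

lemma mat_specializes_mat1: "specializes a a' \<Longrightarrow> mat_specializes (mat1 a) (mat1 a')"
  by (simp add: mat_specializes_def mat_of_rows_list_def)

lemma mat_specializes_mat2:
  "specializes a a' \<Longrightarrow> specializes b b' \<Longrightarrow> specializes c c' \<Longrightarrow> specializes d d' \<Longrightarrow>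
    mat_specializes (mat2 a b c d) (mat2 a' b' c' d')"
  by (auto simp: mat_specializes_def mat_of_rows_list_def numeral_2_eq_2 less_Suc_eq)

lemma mat_specializes_seminormal_mat:
  assumes "specializes t c"
  shows "mat_specializes (seminormal_mat t) (mat2 (c / 2) (1 - c / 2) (1 + c / 2) (- c / 2))"
proof -
  note s = specializes_seminormal_entry[OF assms]
  show ?thesis
    unfolding seminormal_mat_def
    using specializes_diff[OF specializes_diff[OF specializes_q_ind specializes_inverse_q_ind] s]
    by (intro mat_specializes_mat2 s specializes_diff[OF specializes_q_ind s]
        specializes_add[OF specializes_inverse_q_ind s]) simp
qed

lemma mat_specializes_label:
  "mat_specializes (label_T1 \<phi>) (label_s1 \<phi>)" "mat_specializes (label_T2 \<phi>) (label_s2 \<phi>)"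
proof -
  note gens = specializes_p_ind specializes_q_ind specializes_minus[OF specializes_inverse_p_ind]
    specializes_minus[OF specializes_inverse_q_ind]
  show "mat_specializes (label_T1 \<phi>) (label_s1 \<phi>)"
    by (cases \<phi>) (simp_all only: label_T1.simps label_s1.simps mat_specializes_mat1 mat_specializes_mat2 gens specializes_0)
  \<comment> \<open>The entries are kept in the shape of
    \<open>mat_specializes_seminormal_mat\<close> at c = 1 and c = -1.\<close>
  have "label_s2 phi_2_1 = mat2 (1 / 2) (1 - 1 / 2) (1 + 1 / 2) (- 1 / 2)"
    "label_s2 phi_2_2 = mat2 (- 1 / 2) (1 - - 1 / 2) (1 + - 1 / 2) (- (- 1) / 2)"
    by simp_all
  then show "mat_specializes (label_T2 \<phi>) (label_s2 \<phi>)"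
    using mat_specializes_seminormal_mat[OF specializes_1] mat_specializes_seminormal_mat[OF specializes_minus_1]
    by (cases \<phi>) (simp_all only: label_T2.simps label_s2.simps(1-4) mat_specializes_mat1 gens)
qed

lemma wg2_character_mat: "wg2_character \<sigma> g = trace_mat (\<sigma> g)"
  by (simp add: wg2_character_def trace_mat_def diag_mat_def interv_sum_list_conv_sum_set_nat lessThan_atLeast0)

text \<open>The matrices at p = q = 1 satisfy the group relations and so define \<sigma>. Its value
  t at \<open>s1 * s2\<close> is what assigns t = 1 to \<open>phi_2_1\<close> and t = -1 to
  \<open>phi_2_2\<close>.\<close>

lemma specializes_to_label_label_rep: "specializes_to_label (label_dim \<phi>) (label_rep \<phi>) \<phi>"
proof -
  let ?A = "label_s1 \<phi>" and ?B = "label_s2 \<phi>" and ?n = "label_dim \<phi>"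
  note simps1 = mat1_simps[simplified] and simps2 = mat2_simps
  have rels: "?A \<in> carrier_mat ?n ?n" "?B \<in> carrier_mat ?n ?n" "?A * ?A = 1\<^sub>m ?n" "?B * ?B = 1\<^sub>m ?n"
    "?A * (?B * (?A * (?B * (?A * ?B)))) = ?B * (?A * (?B * (?A * (?B * ?A))))"
    by (cases \<phi>; simp add: simps1 simps2)+
  define \<sigma> where "\<sigma> = wg2_mat_rep ?n ?A ?B"
  have rep: "wg2_rep ?n \<sigma>"
    unfolding \<sigma>_def using rels by (rule wg2_rep_wg2_mat_rep)
  have gen: "\<sigma> s1 = ?A" "\<sigma> s2 = ?B"
    unfolding \<sigma>_def using rels by (rule wg2_mat_rep_gen)+
  have hom: "\<sigma> 1 = 1\<^sub>m ?n" "\<sigma> (g * h) = \<sigma> g * \<sigma> h" for g h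
    using rep by (simp_all add: wg2_rep_def)
  have "map (wg2_character \<sigma>) wg2_class_reps = wg2_character_table \<phi>"
    unfolding wg2_class_reps_def power2_eq_square power3_eq_cube
    by (cases \<phi>) (simp_all add: wg2_character_mat hom gen simps1 simps2)
  then show ?thesis
    unfolding specializes_to_label_def using rep gen mat_specializes_label[of \<phi>]
    by (intro exI[of _ \<sigma>]) (simp add: label_rep_gen)
qed

section \<open>Classification\<close>

lemma equivalent_reps_trace:
  assumes "equivalent_reps n \<tau> m \<sigma>" "hg2_rep n \<tau>" "hg2_rep m \<sigma>"
  shows "trace_mat (\<tau> h) = trace_mat (\<sigma> h)"
proof -
  have "m = n" using assms(1) by (simp add: equivalent_reps_def)
  with assms obtain R where R: "R \<in> carrier_mat n n" "invertible_mat R" "R * \<tau> h = \<sigma> h * R"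
    by (auto simp: equivalent_reps_def)
  have carr: "\<tau> h \<in> carrier_mat n n" "\<sigma> h \<in> carrier_mat n n"
    using assms \<open>m = n\<close> by (simp_all add: hg2_rep_def)
  from R(1,2) obtain S where S: "R * S = 1\<^sub>m n" "S * R = 1\<^sub>m (dim_row S)"
    by (auto simp: invertible_mat_def inverts_mat_def)
  \<comment> \<open>\<open>invertible_mat\<close> does not state the size of the inverse; it is
    recovered from the two product identities.\<close>
  have "dim_col S = n" using arg_cong[OF S(1), of dim_col] by simp
  moreover have "dim_row S = n" using arg_cong[OF S(2), of dim_col] R(1) by simp
  ultimately have S_carr: "S \<in> carrier_mat n n" and SR: "S * R = 1\<^sub>m n" using S(2) by auto
  have "trace_mat (\<sigma> h) = trace_mat (\<sigma> h * (R * S))"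
    using S(1) carr by simp
  also have "\<sigma> h * (R * S) = (R * \<tau> h) * S"
    unfolding R(3) using carr R(1) S_carr by (intro assoc_mult_mat[symmetric]) auto
  also have "trace_mat \<dots> = trace_mat (S * (R * \<tau> h))"
    using carr R(1) S_carr by (intro trace_mat_mult_commute[of _ n n]) auto
  also have "S * (R * \<tau> h) = (S * R) * \<tau> h"
    using carr R(1) S_carr by (intro assoc_mult_mat[symmetric]) auto
  finally show ?thesis using SR carr by simp
qed

lemma label_rep_mult: "label_rep \<phi> (x * y) = label_rep \<phi> x * label_rep \<phi> y"
  using hg2_rep_label_rep[of \<phi>] by (simp add: hg2_rep_def)

lemma trace_T1_T2_mat2:
  "trace_mat (mat2 p_ind 0 0 (- inverse p_ind) * seminormal_mat t) = t"
  using seminormal_entry_mult[of t]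
  by (simp add: seminormal_mat_def mat2_simps algebra_simps)

text \<open>In dimension one \<open>T1\<close> and \<open>T2\<close> suffice. The two-dimensional
  representations agree on both generators, so the product is needed: its traces are 1 and
  -1.\<close>

lemma label_determined_by_traces:
  assumes "label_dim \<phi> = label_dim \<psi>"
    and "\<And>h. trace_mat (label_rep \<phi> h) = trace_mat (label_rep \<psi> h)"
  shows "\<phi> = \<psi>"
proof -
  have "(1 :: Cpq) \<noteq> - 1"
    using specializes_nonzero[OF specializes_add[OF specializes_1 specializes_1]] by (simp add: eq_neg_iff_add_eq_0)
  then show ?thesis
    using assms(1) assms(2)[of T1] assms(2)[of T2] assms(2)[of "T1 * T2"]
      minus_inverse_p_ind_neq minus_inverse_q_ind_neq
      minus_inverse_p_ind_neq[symmetric] minus_inverse_q_ind_neq[symmetric]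
    by (cases \<phi>; cases \<psi>) (simp_all add: label_rep_mult label_rep_gen mat1_simps(6)[simplified] trace_T1_T2_mat2)
qed

text \<open>Maps out of a model module are easy to write down, whereas
  \<open>equivalent_reps\<close> asks for the opposite direction; the witness is the inverse
  provided by Schur's lemma.\<close>

lemma equivalent_repsI:
  assumes \<tau>: "irreducible_rep n \<tau>" and \<sigma>: "irreducible_rep m \<sigma>"
    and Q: "Q \<in> carrier_mat n m" "Q \<noteq> 0\<^sub>m n m"
    and gen: "\<tau> T1 * Q = Q * \<sigma> T1" "\<tau> T2 * Q = Q * \<sigma> T2"
  shows "equivalent_reps n \<tau> m \<sigma>"
proof -
  interpret \<tau>: hg2_module n \<tau> using \<tau> by (simp add: irreducible_rep_def hg2_module_def)
  interpret \<sigma>: hg2_module m \<sigma> using \<sigma> by (simp add: irreducible_rep_def hg2_module_def)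
  have comm: "\<tau> h * Q = Q * \<sigma> h" for h
    by (rule \<tau>.intertwinerI[OF \<sigma>.hg2_module_axioms Q(1) gen])
  from Schur_lemma[OF \<sigma> \<tau> Q comm] obtain R where n: "n = m" and R: "R \<in> carrier_mat n n"
    and QR: "Q * R = 1\<^sub>m n" and RQ: "R * Q = 1\<^sub>m n"
    by auto
  have Q': "Q \<in> carrier_mat n n" and \<sigma>': "\<sigma> h \<in> carrier_mat n n" for h
    using Q n \<sigma>.rep_carrier by auto
  have mult: "A * B \<in> carrier_mat n n" "A * B * C = A * (B * C)"
    if "A \<in> carrier_mat n n" "B \<in> carrier_mat n n" "C \<in> carrier_mat n n" for A B C :: "Cpq mat"
    using that by (auto intro: mult_carrier_mat)
  have "R * \<tau> h = \<sigma> h * R" for h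
  proof -
    note carr = R Q' \<sigma>'[of h] \<tau>.rep_carrier[of h]
    have "R * \<tau> h = R * \<tau> h * (Q * R)"
      using R QR \<tau>.rep_carrier[of h] by (simp add: right_mult_one_mat[of _ n n])
    also have "\<dots> = R * (\<tau> h * Q) * R"
      by (simp only: mult(2) carr mult(1)[OF _ _ R])
    also have "\<dots> = (R * Q) * (\<sigma> h * R)"
      unfolding comm by (simp only: mult(2) carr mult(1)[OF _ _ R])
    also have "\<dots> = \<sigma> h * R"
      using RQ R \<sigma>'[of h] by (simp add: left_mult_one_mat[of _ n n])
    finally show ?thesis .
  qed
  moreover have "invertible_mat R"
    using R Q' QR RQ unfolding invertible_mat_def inverts_mat_def by auto
  ultimately show ?thesis
    using R n unfolding equivalent_reps_def by blast
qed

text \<open>The intertwiner sends the standard basis to \<open>v\<close> and \<open>c\<^sup>-\<^sup>1 E2 v - v\<close>: in the seminormal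
  representation, \<open>E2\<close> maps the first basis vector to \<open>c\<close> times the sum of both.\<close>

lemma irreducible_equivalent_label_rep:
  assumes \<tau>: "irreducible_rep n \<tau>"
  shows "\<exists>\<phi>. equivalent_reps n \<tau> (label_dim \<phi>) (label_rep \<phi>)"
proof -
  interpret hg2_module n \<tau> using \<tau> by (simp add: irreducible_rep_def hg2_module_def)
  have "n \<noteq> 0"
  proof
    assume "n = 0"
    then have "carrier_vec n = {0\<^sub>v n :: Cpq vec}" by auto
    with \<tau> show False by (simp add: irreducible_rep_def irreducible_subspace_def)
  qed
  have T1: "\<tau> T1 *\<^sub>v v = \<tau> E1 *\<^sub>v v + (- inverse p_ind) \<cdot>\<^sub>v v"
    and T2: "\<tau> T2 *\<^sub>v v = \<tau> E2 *\<^sub>v v + (- inverse q_ind) \<cdot>\<^sub>v v" if "v \<in> carrier_vec n" for v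
    using that unfolding E1_def E2_def by (auto simp: act_simps)
  from \<open>n \<noteq> 0\<close> show ?thesis
  proof (cases rule: eigenvector_cases)
    case (common v \<alpha> \<beta>)
    \<comment> \<open>Undoing the shift, \<alpha> = 0 means that \<open>T1\<close> acts by -p^-1 and
      the other value that it acts by p; likewise for \<beta> and \<open>T2\<close>. The four
      combinations are the four labels of dimension one.\<close>
    obtain \<phi> where \<phi>: "label_dim \<phi> = 1" "label_T1 \<phi> = mat1 (\<alpha> - inverse p_ind)" "label_T2 \<phi> = mat1 (\<beta> - inverse q_ind)"
    proof -
      consider "\<alpha> = 0" "\<beta> = 0" | "\<alpha> = p_ind + inverse p_ind" "\<beta> = 0"
        | "\<alpha> = 0" "\<beta> = q_ind + inverse q_ind" | "\<alpha> = p_ind + inverse p_ind" "\<beta> = q_ind + inverse q_ind"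
        using common(3,4) by blast
      then show thesis
        by cases (use that[of phi_1_6] that[of phi_1_3a] that[of phi_1_3b] that[of phi_1_0] in simp_all)
    qed
    define Q where "Q = mat_of_cols n [v]"
    have Q: "Q \<in> carrier_mat n 1" by (simp add: Q_def carrier_matI)
    have colQ: "col Q 0 = v" using common(1) by (simp add: Q_def)
    have act: "\<tau> T1 *\<^sub>v v = (\<alpha> - inverse p_ind) \<cdot>\<^sub>v v" "\<tau> T2 *\<^sub>v v = (\<beta> - inverse q_ind) \<cdot>\<^sub>v v"
      using common(1,5,6) by (simp_all add: T1 T2 flip: add_smult_distrib_vec)
    have "\<tau> h * Q = Q * mat1 c" if "\<tau> h *\<^sub>v v = c \<cdot>\<^sub>v v" for h c
    proof (rule eq_matI)
      fix i j assume ij: "i < dim_row (Q * mat1 c)" "j < dim_col (Q * mat1 c)"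
      then have i: "i < n" "j = 0" using Q by (auto simp: mat_of_rows_list_def)
      have "(\<tau> h * Q) $$ (i, j) = (\<tau> h *\<^sub>v v) $ i"
        using i Q colQ by simp
      also have "\<dots> = c * v $ i" using that common(1) i by simp
      also have "\<dots> = (Q * mat1 c) $$ (i, j)"
        using i Q by (simp add: mat_of_rows_list_def scalar_prod_def Q_def mat_of_cols_index)
      finally show "(\<tau> h * Q) $$ (i, j) = (Q * mat1 c) $$ (i, j)" .
    qed (use Q in \<open>simp_all add: mat_of_rows_list_def\<close>)
    from this[OF act(1)] this[OF act(2)] have "\<tau> T1 * Q = Q * label_rep \<phi> T1" "\<tau> T2 * Q = Q * label_rep \<phi> T2"
      by (simp_all add: label_rep_gen \<phi>)
    moreover have "Q \<noteq> 0\<^sub>m n 1" using colQ common(2) by auto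
    ultimately have "equivalent_reps n \<tau> (label_dim \<phi>) (label_rep \<phi>)"
      using \<tau> irreducible_label_rep[of \<phi>] Q unfolding \<phi>(1) by (intro equivalent_repsI)
    then show ?thesis by blast
  next
    case (two v \<kappa>)
    obtain \<phi> t where \<phi>: "label_dim \<phi> = 2" "label_T1 \<phi> = mat2 p_ind 0 0 (- inverse p_ind)"
      "label_T2 \<phi> = seminormal_mat t" and t: "t \<in> {1, -1}" "\<kappa> = ratio_sum + t"
      using two(3) that[of phi_2_1 1] that[of phi_2_2 "- 1"] by auto
    define a where "a = seminormal_entry t"
    define c where "c = inverse q_ind + a"
    have "c \<noteq> 0"
      using t seminormal_entries_nonzero[OF specializes_1] seminormal_entries_nonzero[OF specializes_minus_1]
      by (auto simp: c_def a_def)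
    \<comment> \<open>Adding q^-1 (p + p^-1) to the defining equation of \<open>a\<close> gives c (p
      + p^-1) = s + t.\<close>
    have \<kappa>: "inverse c * \<kappa> = p_ind + inverse p_ind"
    proof -
      have "\<kappa> = c * (p_ind + inverse p_ind)"
        using seminormal_entry_mult[of t]
        by (simp add: t(2) c_def a_def ratio_sum_def divide_inverse algebra_simps)
      with \<open>c \<noteq> 0\<close> show ?thesis by (simp flip: mult.assoc)
    qed
    \<comment> \<open>By the previous identity \<open>E1\<close> sends c^-1 \<open>E2\<close> v to
      (p + p^-1) v; subtracting \<open>v\<close> therefore lands in the kernel of
      \<open>E1\<close>.\<close>
    define w where "w = inverse c \<cdot>\<^sub>v (\<tau> E2 *\<^sub>v v) + (- 1) \<cdot>\<^sub>v v"
    have v: "v \<in> carrier_vec n" and w: "w \<in> carrier_vec n"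
      using two(1) by (simp_all add: w_def)
    have E2v: "\<tau> E2 *\<^sub>v v = c \<cdot>\<^sub>v v + c \<cdot>\<^sub>v w"
      using v \<open>c \<noteq> 0\<close> by (intro eq_vecI) (auto simp: w_def algebra_simps simp del: index_mult_mat_vec)
    have E1w: "\<tau> E1 *\<^sub>v w = 0\<^sub>v n"
      using v two(4,5) \<kappa>
      by (auto simp: w_def act_vec_add act_simps smult_smult_assoc simp flip: add_smult_distrib_vec)
    \<comment> \<open>\<open>E2\<close> maps \<open>v\<close> to c (v + w) and scales v + w by q +
      q^-1, so \<open>w\<close> goes to the difference of these multiples.\<close>
    have E2w: "\<tau> E2 *\<^sub>v w = (q_ind + inverse q_ind - c) \<cdot>\<^sub>v v + (q_ind + inverse q_ind - c) \<cdot>\<^sub>v w"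
    proof -
      have "\<tau> E2 *\<^sub>v w = (inverse c * (q_ind + inverse q_ind)) \<cdot>\<^sub>v (\<tau> E2 *\<^sub>v v) + (- 1) \<cdot>\<^sub>v (\<tau> E2 *\<^sub>v v)"
        using v by (simp add: w_def act_vec_add act_simps smult_smult_assoc E2_E2_act)
      also have "\<dots> = (q_ind + inverse q_ind - c) \<cdot>\<^sub>v v + (q_ind + inverse q_ind - c) \<cdot>\<^sub>v w"
        unfolding E2v using v w \<open>c \<noteq> 0\<close> by (intro eq_vecI) (auto simp: field_simps)
      finally show ?thesis .
    qed
    have T1v: "\<tau> T1 *\<^sub>v v = p_ind \<cdot>\<^sub>v v + 0 \<cdot>\<^sub>v w"
      using v w by (intro eq_vecI) (auto simp: T1 two(4) algebra_simps)
    have T1w: "\<tau> T1 *\<^sub>v w = 0 \<cdot>\<^sub>v v + (- inverse p_ind) \<cdot>\<^sub>v w"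
      using v w by (intro eq_vecI) (auto simp: T1 E1w)
    have T2v: "\<tau> T2 *\<^sub>v v = a \<cdot>\<^sub>v v + (inverse q_ind + a) \<cdot>\<^sub>v w"
      using v w by (intro eq_vecI) (auto simp: T2 E2v c_def algebra_simps)
    have T2w: "\<tau> T2 *\<^sub>v w = (q_ind - a) \<cdot>\<^sub>v v + (q_ind - inverse q_ind - a) \<cdot>\<^sub>v w"
      using v w by (intro eq_vecI) (auto simp: T2 E2w c_def algebra_simps)
    define Q where "Q = mat_of_cols n [v, w]"
    have Q: "Q \<in> carrier_mat n 2" by (simp add: Q_def carrier_matI)
    have colQ: "col Q 0 = v" "col Q (Suc 0) = w" using v w by (simp_all add: Q_def)
    have "\<tau> h * Q = Q * mat2 k l r s"
      if h: "\<tau> h *\<^sub>v v = k \<cdot>\<^sub>v v + r \<cdot>\<^sub>v w" "\<tau> h *\<^sub>v w = l \<cdot>\<^sub>v v + s \<cdot>\<^sub>v w" for h k l r s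
    proof (rule eq_matI)
      fix i j assume ij: "i < dim_row (Q * mat2 k l r s)" "j < dim_col (Q * mat2 k l r s)"
      then have i: "i < n" and j: "j = 0 \<or> j = Suc 0"
        using Q by (auto simp: mat_of_rows_list_def numeral_2_eq_2 less_Suc_eq)
      have "(\<tau> h * Q) $$ (i, j) = (\<tau> h *\<^sub>v col Q j) $ i"
        using i j Q by auto
      also have "\<dots> = (Q * mat2 k l r s) $$ (i, j)"
        using j
      proof
        assume "j = 0"
        then show ?thesis using i v w
          by (simp add: colQ h mat_of_rows_list_def scalar_prod_def Q_def mat_of_cols_index numeral_2_eq_2 mult.commute
              del: index_mult_mat_vec)
      next
        assume "j = Suc 0"
        then show ?thesis using i v w
          by (simp add: colQ h mat_of_rows_list_def scalar_prod_def Q_def mat_of_cols_index numeral_2_eq_2 mult.commute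
              del: index_mult_mat_vec)
      qed
      finally show "(\<tau> h * Q) $$ (i, j) = (Q * mat2 k l r s) $$ (i, j)" .
    qed (use Q in \<open>simp_all add: mat_of_rows_list_def\<close>)
    from this[OF T1v T1w] this[OF T2v T2w]
    have "\<tau> T1 * Q = Q * label_rep \<phi> T1" "\<tau> T2 * Q = Q * label_rep \<phi> T2"
      by (simp_all add: label_rep_gen \<phi> seminormal_mat_def a_def)
    \<comment> \<open>One nonzero column suffices: that \<open>v\<close> and \<open>w\<close> form a
      basis and that \<open>n\<close> is 2 comes out of Schur's lemma.\<close>
    moreover have "Q \<noteq> 0\<^sub>m n 2" using colQ(1) two(2) by auto
    ultimately have "equivalent_reps n \<tau> (label_dim \<phi>) (label_rep \<phi>)"
      using \<tau> irreducible_label_rep[of \<phi>] Q unfolding \<phi>(1) by (intro equivalent_repsI)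
    then show ?thesis by blast
  qed
qed

lemma irreducible_equivalent_unique_label_rep:
  assumes "irreducible_rep n \<tau>"
  shows "\<exists>!\<phi>. equivalent_reps n \<tau> (label_dim \<phi>) (label_rep \<phi>)"
proof (rule ex_ex1I)
  show "\<exists>\<phi>. equivalent_reps n \<tau> (label_dim \<phi>) (label_rep \<phi>)"
    by (rule irreducible_equivalent_label_rep[OF assms])
next
  fix \<phi> \<psi>
  assume eq: "equivalent_reps n \<tau> (label_dim \<phi>) (label_rep \<phi>)" "equivalent_reps n \<tau> (label_dim \<psi>) (label_rep \<psi>)"
  have rep: "hg2_rep n \<tau>" using assms by (simp add: irreducible_rep_def)
  show "\<phi> = \<psi>"
  proof (rule label_determined_by_traces)
    show "label_dim \<phi> = label_dim \<psi>" using eq by (simp add: equivalent_reps_def)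
    show "trace_mat (label_rep \<phi> h) = trace_mat (label_rep \<psi> h)" for h
      using equivalent_reps_trace[OF eq(1) rep hg2_rep_label_rep] equivalent_reps_trace[OF eq(2) rep hg2_rep_label_rep]
      by metis
  qed
qed

text \<open>Each \<rho> \<phi> is determined by its values on the generators. The last conjunct says
  that the six representations exhaust the irreducible ones and, applied to the six themselves, that
  they are pairwise inequivalent.\<close>

theorem theorem6p11:
  fixes p q a b c d x y z w :: Cpq
  assumes "p = p_ind" and "q = q_ind"
    and "a = (1 + inverse p * (q - inverse q)) / (p + inverse p)"
    and "b = q - a" and "c = inverse q + a" and "d = (q - inverse q) - a"
    and "x = (- 1 + inverse p * (q - inverse q)) / (p + inverse p)"
    and "y = q - x" and "z = inverse q + x" and "w = (q - inverse q) - x"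
  shows "\<exists>\<rho> :: wg2_label \<Rightarrow> hg2 \<Rightarrow> Cpq mat.
    \<rho> phi_1_0 T1 = mat_of_rows_list 1 [[p]] \<and>
    \<rho> phi_1_0 T2 = mat_of_rows_list 1 [[q]] \<and>
    \<rho> phi_1_6 T1 = mat_of_rows_list 1 [[- inverse p]] \<and>
    \<rho> phi_1_6 T2 = mat_of_rows_list 1 [[- inverse q]] \<and>
    \<rho> phi_1_3a T1 = mat_of_rows_list 1 [[p]] \<and>
    \<rho> phi_1_3a T2 = mat_of_rows_list 1 [[- inverse q]] \<and>
    \<rho> phi_1_3b T1 = mat_of_rows_list 1 [[- inverse p]] \<and>
    \<rho> phi_1_3b T2 = mat_of_rows_list 1 [[q]] \<and>
    \<rho> phi_2_1 T1 = mat_of_rows_list 2 [[p, 0], [0, - inverse p]] \<and>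
    \<rho> phi_2_1 T2 = mat_of_rows_list 2 [[a, b], [c, d]] \<and>
    \<rho> phi_2_2 T1 = mat_of_rows_list 2 [[p, 0], [0, - inverse p]] \<and>
    \<rho> phi_2_2 T2 = mat_of_rows_list 2 [[x, y], [z, w]] \<and>
    (\<forall>\<phi>. irreducible_seminormal_rep (label_dim \<phi>) (\<rho> \<phi>) \<and>
         specializes_to_label (label_dim \<phi>) (\<rho> \<phi>) \<phi>) \<and>
    (\<forall>n \<tau>. irreducible_rep n \<tau> \<longrightarrow> (\<exists>!\<phi>. equivalent_reps n \<tau> (label_dim \<phi>) (\<rho> \<phi>)))"
  using irreducible_seminormal_label_rep specializes_to_label_label_rep irreducible_equivalent_unique_label_rep
  by (intro exI[of _ label_rep])
    (simp add: label_rep_gen assms(1,2) assms(3-10)[unfolded assms(1,2)] seminormal_mat_def seminormal_entry_def)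

end
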